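(* Let $x(t+1)=Ax(t)+\sum_{i=1}^mB_iu_i(t)$, $y_i(t)=C_ix(t)$ be an $n$-dimensional, jointly controllable and jointly observable $m$-channel discrete-time linear system whose neighbor graph is weakly connected, with time-invariant integer transmission delays $d_{ij}\ge0$ from agent $i$ to each follower $j$ of $i$ ($d_{ii}=0$), and let $d_i=\max_{j\in\mathcal{F}_i}d_{ij}$. Let nonnegative integers $n_1,\dots,n_m$ be given, let $N_z=\sum_{k}(d_k+1)n_k$ and $\tilde n=n+N_z$. For $0\le\delta\le d_i$ let $H_{i\delta}$ be the $N_z\times n_i$ block column matrix, partitioned into blocks of sizes $(d_1+1)n_1,\dots,(d_m+1)n_m$, whose $k$th block is zero for $k\ne i$ and whose $i$th block is $\mathrm{column}\{\mathbf{0}_{\delta n_i\times n_i},I_{n_i},\mathbf{0}_{(d_i-\delta)n_i\times n_i}\}$. Define the extended system $\{\tilde A,\tilde B_i,\tilde C_i;m\}$ by $$\tilde A=\mathrm{blockdiag}\Big\{A,\ \begin{bmatrix}0&\mathbf{0}_{n_1}\\ I_{d_1n_1}&0\end{bmatrix},\dots,\begin{bmatrix}0&\mathbf{0}_{n_m}\\ I_{d_mn_m}&0\end{bmatrix}\Big\},\quad \tilde B_i=\begin{bmatrix}B_i&0\\0&H_{i0}\end{bmatrix},\quad \tilde C_i=\begin{bmatrix}C_i&0\\0&H_{j_1d_{j_1i}}'\\ \vdots&\vdots\\0&H_{j_{m_i}d_{j_{m_i}i}}'\end{bmatrix},$$ where $\mathcal{N}_i=\{j_1,\dots,j_{m_i}\}$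 and the $k$th diagonal block after $A$ is the $(d_k+1)n_k\times(d_k+1)n_k$ block shift matrix (zero first block row, $I_{d_kn_k}$ in the lower-left position). (This models local controllers $z_i(t+1)=v_i(t)$ with state $\mathrm{column}\{x(t),z_1(t),\dots,z_1(t-d_1),\dots,z_m(t),\dots,z_m(t-d_m)\}$, inputs $\mathrm{column}\{u_i,v_i\}$, and agent $i$ measuring $y_i(t)$ and $z_j(t-d_{ji})$, $j\in\mathcal{N}_i$.) Suppose $$n_i\ \ge\ n-\min_{\mathbf{s}\subset\{1,\dots,m\},\ \lambda\in\sigma(A)}\mathrm{rank}\begin{bmatrix}\lambda I_n-A & B_{\mathbf{s}}\\ C_{\{1,\dots,m\}-\mathbf{s}}&0\end{bmatrix}\quad\text{for all } i.$$ Then for any nonzero complex number $\lambda$: $\lambda$ is not a fixed eigenvalue of $\{\tilde A,\tilde B_i,\tilde C_i;m\}$ if and only if $\mathcal{N}_{\{1,\dots,m\}-\mathbf{s}}\cap\mathbf{s}\neq\emptyset$ for every subset $\mathbf{s}\subset\{1,\dots,m\}$ with $\mathrm{rank}\begin{bmatrix}\lambda I_n-A&B_{\mathbf{s}}\\C_{\{1,\dots,m\}-\mathbf{s}}&0\end{bmatrix}<n$.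
   Context: Jointly controllable: $(A,[B_1\ \cdots\ B_m])$ controllable; jointly observable: $(\mathrm{column}\{C_1,\dots,C_m\},A)$ observable. The neighbor graph is a directed graph on $\{1,\dots,m\}$ with an arc $j\to i$ iff $j$ is a neighbor of $i$ (agent $i$ receives information from $j$); $\mathcal{N}_i$ is the set of neighbors of $i$ including $i$, $\mathcal{N}_{\mathbf{s}}=\bigcup_{i\in\mathbf{s}}\mathcal{N}_i$. Agent $j$ is a follower of agent $i$ if $j$ receives information from $i$ (i.e., $i\in\mathcal{N}_j$); $\mathcal{F}_i$ is the set of followers of $i$ including $i$. Weakly connected: removing self-arcs and replacing arcs by undirected edges yields a connected graph. $B_{\mathbf{s}}=[B_{i_1}\ \cdots\ B_{i_s}]$, $C_{\mathbf{s}}=\mathrm{column}\{C_{i_1},\dots,C_{i_s}\}$ for $\mathbf{s}=\{i_1<\dots<i_s\}$. A fixed eigenvalue of an $m$-channel system $\{A,B_i,C_i;m\}$ is an eigenvalue of $A+\sum_iB_iF_iC_i$ that does not change as the real matrices $F_i$ range over all values. *)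

theory Defs
  imports "Jordan_Normal_Form.Char_Poly" "Jordan_Normal_Form.DL_Rank"
begin

text \<open>Agents are indexed by 0,...,m-1.  All matrices are Jordan_Normal_Form matrices.\<close>

definition mrank :: "'a::field mat \<Rightarrow> nat" where
  "mrank M = vec_space.rank (dim_row M) M"

definition hcat :: "'a::zero mat \<Rightarrow> 'a mat \<Rightarrow> 'a mat" where
  "hcat M1 M2 = mat (dim_row M1) (dim_col M1 + dim_col M2)
     (\<lambda>(r,c). if c < dim_col M1 then M1 $$ (r,c) else M2 $$ (r, c - dim_col M1))"

definition vcat :: "'a::zero mat \<Rightarrow> 'a mat \<Rightarrow> 'a mat" where
  "vcat M1 M2 = mat (dim_row M1 + dim_row M2) (dim_col M1)
     (\<lambda>(r,c). if r < dim_row M1 then M1 $$ (r,c) else M2 $$ (r - dim_row M1, c))"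

text \<open>Horizontal concatenation of a list of matrices with r rows; vertical of a list with c columns.\<close>
definition hcat_list :: "nat \<Rightarrow> 'a::zero mat list \<Rightarrow> 'a mat" where
  "hcat_list r Ms = foldr hcat Ms (0\<^sub>m r 0)"

definition vcat_list :: "nat \<Rightarrow> 'a::zero mat list \<Rightarrow> 'a mat" where
  "vcat_list c Ms = foldr vcat Ms (0\<^sub>m 0 c)"

definition blockdiag :: "'a::zero mat \<Rightarrow> 'a mat \<Rightarrow> 'a mat" where
  "blockdiag M1 M2 = four_block_mat M1 (0\<^sub>m (dim_row M1) (dim_col M2))
                                      (0\<^sub>m (dim_row M2) (dim_col M1)) M2"

definition blockdiag_list :: "'a::zero mat list \<Rightarrow> 'a mat" where
  "blockdiag_list Ms = foldr blockdiag Ms (0\<^sub>m 0 0)"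

text \<open>B_s = [B_{i1} ... B_{is}] and C_s = column{C_{i1},...,C_{is}} for s = {i1 < ... < is}.\<close>
definition B_sub :: "nat \<Rightarrow> (nat \<Rightarrow> 'a::zero mat) \<Rightarrow> nat set \<Rightarrow> 'a mat" where
  "B_sub n B s = hcat_list n (map B (sorted_list_of_set s))"

definition C_sub :: "nat \<Rightarrow> (nat \<Rightarrow> 'a::zero mat) \<Rightarrow> nat set \<Rightarrow> 'a mat" where
  "C_sub n C s = vcat_list n (map C (sorted_list_of_set s))"

text \<open>Controllability / observability (Kalman rank conditions), for n x n matrix A.\<close>
definition controllable :: "real mat \<Rightarrow> real mat \<Rightarrow> bool" where
  "controllable A B = (let n = dim_row A in
     mrank (hcat_list n (map (\<lambda>k. (A ^\<^sub>m k) * B) [0..<n])) = n)"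

definition observable :: "real mat \<Rightarrow> real mat \<Rightarrow> bool" where
  "observable C A = (let n = dim_row A in
     mrank (vcat_list n (map (\<lambda>k. C * (A ^\<^sub>m k)) [0..<n])) = n)"

definition jointly_controllable :: "nat \<Rightarrow> real mat \<Rightarrow> (nat \<Rightarrow> real mat) \<Rightarrow> bool" where
  "jointly_controllable m A B = controllable A (B_sub (dim_row A) B {0..<m})"

definition jointly_observable :: "nat \<Rightarrow> real mat \<Rightarrow> (nat \<Rightarrow> real mat) \<Rightarrow> bool" where
  "jointly_observable m A C = observable (C_sub (dim_row A) C {0..<m}) A"

text \<open>Neighbor graph given by neighbor sets N i (including i): arc j -> i iff j \<in> N i.\<close>
definition weakly_connected :: "nat \<Rightarrow> (nat \<Rightarrow> nat set) \<Rightarrow> bool" where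
  "weakly_connected m N =
     (\<forall>i<m. \<forall>j<m. (i, j) \<in> ({(a, b). a < m \<and> b < m \<and> a \<noteq> b \<and> (a \<in> N b \<or> b \<in> N a)})\<^sup>*)"

definition N_set :: "(nat \<Rightarrow> nat set) \<Rightarrow> nat set \<Rightarrow> nat set" where
  "N_set N s = (\<Union>i\<in>s. N i)"

text \<open>Followers of i (including i).\<close>
definition followers :: "nat \<Rightarrow> (nat \<Rightarrow> nat set) \<Rightarrow> nat \<Rightarrow> nat set" where
  "followers m N i = {j. j < m \<and> i \<in> N j}"

text \<open>d_i = max over followers j of d_{ij}\<close>
definition dmax :: "nat \<Rightarrow> (nat \<Rightarrow> nat set) \<Rightarrow> (nat \<Rightarrow> nat \<Rightarrow> nat) \<Rightarrow> nat \<Rightarrow> nat" where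
  "dmax m N d i = Max (d i ` followers m N i)"

text \<open>Complex spectrum of a real square matrix.\<close>
definition spectrum_c :: "real mat \<Rightarrow> complex set" where
  "spectrum_c A = {z. eigenvalue (map_mat complex_of_real A) z}"

text \<open>Fixed eigenvalue of the m-channel system {A, B_i, C_i; m}.\<close>
definition feedback_mat :: "nat \<Rightarrow> real mat \<Rightarrow> (nat \<Rightarrow> real mat) \<Rightarrow> (nat \<Rightarrow> real mat)
    \<Rightarrow> (nat \<Rightarrow> real mat) \<Rightarrow> real mat" where
  "feedback_mat m A B C F =
     A + foldr (\<lambda>i M. B i * F i * C i + M) [0..<m] (0\<^sub>m (dim_row A) (dim_col A))"

definition fixed_eigenvalue :: "nat \<Rightarrow> real mat \<Rightarrow> (nat \<Rightarrow> real mat) \<Rightarrow> (nat \<Rightarrow> real mat)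
    \<Rightarrow> complex \<Rightarrow> bool" where
  "fixed_eigenvalue m A B C lam =
     (\<forall>F. (\<forall>i<m. F i \<in> carrier_mat (dim_col (B i)) (dim_row (C i))) \<longrightarrow>
          eigenvalue (map_mat complex_of_real (feedback_mat m A B C F)) lam)"

text \<open>The rank test matrix [lambda I - A, B_s; C_{complement of s}, 0] (complex).\<close>
definition test_mat :: "nat \<Rightarrow> real mat \<Rightarrow> (nat \<Rightarrow> real mat) \<Rightarrow> (nat \<Rightarrow> real mat)
    \<Rightarrow> nat set \<Rightarrow> complex \<Rightarrow> complex mat" where
  "test_mat m A B C s lam =
     (let n = dim_row A; Bs = B_sub n B s; Cs = C_sub n C ({0..<m} - s) in
      four_block_mat (lam \<cdot>\<^sub>m 1\<^sub>m n - map_mat complex_of_real A) (map_mat complex_of_real Bs)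
                     (map_mat complex_of_real Cs) (0\<^sub>m (dim_row Cs) (dim_col Bs)))"

subsection \<open>The extended system\<close>

text \<open>nz k = n_k, dd k = d_k.  Offset of the k-th z-block, and N_z.\<close>
definition zoff :: "(nat \<Rightarrow> nat) \<Rightarrow> (nat \<Rightarrow> nat) \<Rightarrow> nat \<Rightarrow> nat" where
  "zoff nz dd i = (\<Sum>k<i. (dd k + 1) * nz k)"

definition Nz :: "nat \<Rightarrow> (nat \<Rightarrow> nat) \<Rightarrow> (nat \<Rightarrow> nat) \<Rightarrow> nat" where
  "Nz m nz dd = zoff nz dd m"

text \<open>H_{i delta}: N_z x n_i, i-th block = column{0_{delta n_i x n_i}, I_{n_i}, 0}.\<close>
definition Hmat :: "nat \<Rightarrow> (nat \<Rightarrow> nat) \<Rightarrow> (nat \<Rightarrow> nat) \<Rightarrow> nat \<Rightarrow> nat \<Rightarrow> real mat" where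
  "Hmat m nz dd i delta = mat (Nz m nz dd) (nz i)
     (\<lambda>(r,c). if r = zoff nz dd i + delta * nz i + c then 1 else 0)"

text \<open>Block shift matrix of size (d+1)k: zero first block row, I_{dk} in the lower-left.\<close>
definition shift_mat :: "nat \<Rightarrow> nat \<Rightarrow> real mat" where
  "shift_mat k d = mat ((d + 1) * k) ((d + 1) * k) (\<lambda>(r,c). if r = c + k then 1 else 0)"

definition A_ext :: "nat \<Rightarrow> real mat \<Rightarrow> (nat \<Rightarrow> nat) \<Rightarrow> (nat \<Rightarrow> nat) \<Rightarrow> real mat" where
  "A_ext m A nz dd = blockdiag A (blockdiag_list (map (\<lambda>k. shift_mat (nz k) (dd k)) [0..<m]))"

definition B_ext :: "nat \<Rightarrow> (nat \<Rightarrow> real mat) \<Rightarrow> (nat \<Rightarrow> nat) \<Rightarrow> (nat \<Rightarrow> nat) \<Rightarrow> nat \<Rightarrow> real mat" where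
  "B_ext m B nz dd i = blockdiag (B i) (Hmat m nz dd i 0)"

definition C_ext :: "nat \<Rightarrow> nat \<Rightarrow> (nat \<Rightarrow> real mat) \<Rightarrow> (nat \<Rightarrow> nat set) \<Rightarrow> (nat \<Rightarrow> nat \<Rightarrow> nat)
    \<Rightarrow> (nat \<Rightarrow> nat) \<Rightarrow> (nat \<Rightarrow> nat) \<Rightarrow> nat \<Rightarrow> real mat" where
  "C_ext n m C N d nz dd i =
     vcat (hcat (C i) (0\<^sub>m (dim_row (C i)) (Nz m nz dd)))
          (vcat_list (n + Nz m nz dd)
             (map (\<lambda>j. hcat (0\<^sub>m (nz j) n) (transpose_mat (Hmat m nz dd j (d j i))))
                  (sorted_list_of_set (N i))))"

end

theory Submission
  imports Defs "HOL-Library.Function_Algebras"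
begin

text \<open>
  The fixed modes are described by the rank criterion of Anderson and Clements: \<open>\<lambda>\<close> is a fixed
  eigenvalue iff the test matrix of some channel subset \<open>s\<close> has rank below the state dimension.
  For its hard half, every entry of every feedback matrix is a scalar gain on a rank-one term
  \<open>u\<^sub>k v\<^sub>k\<^sup>T\<close>.  Adjoining an extra coordinate \<open>e\<^sub>k\<close> for each of them turns the choice between gain
  0 and gain 1 into the choice of \<open>e\<^sub>k\<close> or \<open>e\<^sub>k + u\<^sub>k\<close>, so that Rado's theorem on independent
  transversals yields either a nonsingular 0/1 choice or a deficient set.

  For \<open>\<lambda> \<noteq> 0\<close> the delay lines contribute exactly \<open>N\<^sub>z\<close> to the rank of the test matrix of the
  extended system if no agent outside \<open>s\<close> hears an agent in \<open>s\<close>, and at least \<open>N\<^sub>z + n\<^sub>j\<close> if some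
  agent outside \<open>s\<close> hears \<open>j \<in> s\<close>; the bound on \<open>n\<^sub>j\<close> then closes the rank gap.
\<close>

subsection \<open>Dimension and independent transversals\<close>

text \<open>Gains 0 and 1 are real, so the reality of the \<open>F i\<close> costs nothing although
  \<open>lam\<close> is complex, and no genericity argument on determinants is needed. What Rado's
  theorem returns, however, is a deficient set of triples (channel, input, output), which need not
  be a union of whole channels. It is turned into a channel set by putting into \<open>s\<close>
  exactly the channels all of whose inputs occur in it. A channel left out has an input none of
  whose triples occurs, and through that input all outputs of the channel are still visible. Ranks
  are replaced by dimensions of finite sets of functions. Rows can then carry labels of any type,
  pairs for the test matrices and triples in the transversal argument, and matrices with different
  row labels are compared by substituting labels, without regard to the order of concatenation. The
  bound on \<open>n_j\<close> speaks only of eigenvalues of \<open>A\<close>; a deficient test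
  matrix of the original system makes \<open>lam\<close> a fixed eigenvalue of that system, hence,
  with zero gains, an eigenvalue of \<open>A\<close>.\<close>

context vector_space
begin

lemma obtain_finite_basis:
  assumes "finite V"
  obtains B where "B \<subseteq> V" "finite B" "independent B" "V \<subseteq> span B" "card B = dim V"
  by (metis assms basis_exists rev_finite_subset)

lemma dim_mono_finite:
  assumes "finite Y" "X \<subseteq> span Y"
  shows "dim X \<le> dim Y"
proof -
  obtain B where B: "finite B" "Y \<subseteq> span B" "card B = dim Y"
    using obtain_finite_basis[OF assms(1)] by metis
  then have "X \<subseteq> span B" using assms(2) by (metis span_mono span_span subset_trans)
  then show ?thesis using dim_le_card[of X B] B by simp
qed

lemma dim_subset_finite: "finite Y \<Longrightarrow> X \<subseteq> Y \<Longrightarrow> dim X \<le> dim Y"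
  by (rule dim_mono_finite) (use span_superset in blast)+

text \<open>A basis of \<open>X \<inter> Y\<close> is extended to bases of \<open>X\<close> and of
  \<open>Y\<close>; the union of these spans \<open>X \<union> Y\<close>, and their intersection
  contains the common part. The intersection meant is that of the sets of vectors, not of their
  spans.\<close>

lemma dim_submodular:
  assumes "finite X" "finite Y"
  shows "dim (X \<union> Y) + dim (X \<inter> Y) \<le> dim X + dim Y"
proof -
  obtain B where B: "B \<subseteq> X \<inter> Y" "finite B" "independent B" "card B = dim (X \<inter> Y)"
    using obtain_finite_basis[of "X \<inter> Y"] assms by (metis finite_Int)
  obtain BX where BX: "B \<subseteq> BX" "BX \<subseteq> X" "independent BX" "X \<subseteq> span BX"
    using maximal_independent_subset_extend[of B X] B by blast
  obtain BY where BY: "B \<subseteq> BY" "BY \<subseteq> Y" "independent BY" "Y \<subseteq> span BY"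
    using maximal_independent_subset_extend[of B Y] B by blast
  have fin: "finite BX" "finite BY" using BX BY assms by (auto intro: finite_subset)
  have card: "card BX = dim X" "card BY = dim Y"
    using basis_card_eq_dim BX BY by blast+
  have "X \<union> Y \<subseteq> span (BX \<union> BY)"
    using BX BY span_mono[of BX "BX \<union> BY"] span_mono[of BY "BX \<union> BY"] by blast
  then have "dim (X \<union> Y) \<le> card (BX \<union> BY)" using dim_le_card fin by blast
  moreover have "card (BX \<union> BY) + card (BX \<inter> BY) = card BX + card BY"
    using card_Un_Int fin by metis
  moreover have "card B \<le> card (BX \<inter> BY)" using B BX BY fin by (intro card_mono) auto
  ultimately show ?thesis using B card by linarith
qed

lemma dim_Un_le: "finite X \<Longrightarrow> finite Y \<Longrightarrow> dim (X \<union> Y) \<le> dim X + dim Y"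
  using dim_submodular by (meson add_leD1)

text \<open>This is Rado's theorem on independent transversals for the sets \<open>{x k, y k}\<close>, relative to \<open>W\<close>.\<close>

lemma rado_pairs:
  assumes "finite K" "finite W"
    and "\<And>T. T \<subseteq> K \<Longrightarrow> dim (W \<union> x ` (K - T) \<union> y ` T) < r + card K"
  shows "\<exists>S \<subseteq> K. dim (W \<union> x ` S \<union> y ` S) < r + card S"
  using assms
proof (induction K arbitrary: W r rule: finite_induct)
  case empty
  then show ?case by auto
next
  case (insert k K)
  \<comment> \<open>The choice at \<open>k\<close> is committed to \<open>x k\<close>: the vector
    joins \<open>W\<close>, and the threshold \<open>r\<close> rises by one in exchange for the
    index \<open>k\<close>.\<close>
  have "\<exists>S \<subseteq> K. dim (insert (x k) W \<union> x ` S \<union> y ` S) < Suc r + card S"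
  proof (rule insert.IH)
    fix T assume T: "T \<subseteq> K"
    then have eq: "insert k K - T = insert k (K - T)" using insert.hyps by auto
    show "dim (insert (x k) W \<union> x ` (K - T) \<union> y ` T) < Suc r + card K"
      using insert.prems(2)[of T] T insert.hyps unfolding eq by (simp add: subset_insertI2)
  qed (use insert.prems in auto)
  then obtain S where S: "S \<subseteq> K" "dim (insert (x k) W \<union> x ` S \<union> y ` S) < Suc r + card S"
    by blast
  have "\<exists>S \<subseteq> K. dim (insert (y k) W \<union> x ` S \<union> y ` S) < Suc r + card S"
  proof (rule insert.IH)
    fix T assume T: "T \<subseteq> K"
    then have eq: "insert k K - insert k T = K - T" using insert.hyps by auto
    show "dim (insert (y k) W \<union> x ` (K - T) \<union> y ` T) < Suc r + card K"
      using insert.prems(2)[OF insert_mono[OF T]] insert.hyps unfolding eq by simp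
  qed (use insert.prems in auto)
  then obtain S' where S': "S' \<subseteq> K" "dim (insert (y k) W \<union> x ` S' \<union> y ` S') < Suc r + card S'"
    by blast
  \<comment> \<open>Uncrossing. Both families have dimension at most \<open>r\<close> plus the size
    of their index set. Their union also contains both vectors of \<open>k\<close>, so
    \<open>?U\<close> gains an index for free, and by submodularity \<open>?U\<close> or
    \<open>?I\<close> has to be deficient.\<close>
  let ?X = "insert (x k) W \<union> x ` S \<union> y ` S" and ?Y = "insert (y k) W \<union> x ` S' \<union> y ` S'"
  let ?I = "S \<inter> S'" and ?U = "insert k (S \<union> S')"
  have fS: "finite S" "finite S'" using S(1) S'(1) insert.hyps finite_subset by blast+
  then have fin: "finite ?X" "finite ?Y" using insert.prems by auto
  have kU: "k \<notin> S \<union> S'" using S(1) S'(1) insert.hyps by blast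
  have "dim (W \<union> x ` ?U \<union> y ` ?U) \<le> dim (?X \<union> ?Y)"
    by (rule dim_subset_finite) (use fin in auto)
  moreover have "dim (W \<union> x ` ?I \<union> y ` ?I) \<le> dim (?X \<inter> ?Y)"
    by (rule dim_subset_finite) (use fin in auto)
  moreover have "card ?U = Suc (card (S \<union> S'))" using kU fS by simp
  moreover have "card S + card S' = card (S \<union> S') + card ?I" using card_Un_Int fS by blast
  ultimately have "dim (W \<union> x ` ?U \<union> y ` ?U) < r + card ?U \<or> dim (W \<union> x ` ?I \<union> y ` ?I) < r + card ?I"
    using dim_submodular[OF fin] S(2) S'(2) by linarith
  moreover have "?U \<subseteq> insert k K" "?I \<subseteq> insert k K" using S(1) S'(1) by auto
  ultimately show ?case by blast
qed

text \<open>The count is over indices and not over vectors, so that a repeated vector is a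
  dependence of the family. The next lemma is the converse.\<close>

lemma dim_image_less_card:
  assumes I: "finite I" "i \<in> I" and rel: "(\<Sum>j\<in>I. a j *s g j) = 0" "a i \<noteq> 0"
  shows "dim (g ` I) < card I"
proof -
  have "(\<Sum>j\<in>I. a j *s g j) = a i *s g i + (\<Sum>j\<in>I - {i}. a j *s g j)"
    using I by (rule sum.remove)
  then have "a i *s g i = - (\<Sum>j\<in>I - {i}. a j *s g j)"
    using rel(1) by (simp add: eq_neg_iff_add_eq_0)
  then have "inverse (a i) *s (a i *s g i) = - (inverse (a i) *s (\<Sum>j\<in>I - {i}. a j *s g j))"
    by simp
  then have "g i = - (inverse (a i) *s (\<Sum>j\<in>I - {i}. a j *s g j))" using rel(2) by simp
  also have "\<dots> \<in> span (g ` (I - {i}))"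
    by (intro span_neg span_scale span_sum span_base imageI)
  finally have "g ` I \<subseteq> span (g ` (I - {i}))" by (auto intro: span_base)
  then have "dim (g ` I) \<le> card (g ` (I - {i}))" using dim_le_card I by blast
  also have "\<dots> \<le> card (I - {i})" using card_image_le I by blast
  also have "\<dots> < card I" using I by (meson card_Diff1_less)
  finally show ?thesis .
qed

lemma dim_image_less_cardD:
  assumes I: "finite I" and "dim (g ` I) < card I"
  obtains a i where "i \<in> I" "a i \<noteq> 0" "(\<Sum>j\<in>I. a j *s g j) = 0"
proof (cases "inj_on g I")
  case True
  then have "dependent (g ` I)" using assms dim_eq_card_independent card_image by force
  then obtain u v where uv: "v \<in> g ` I" "u v \<noteq> 0" "(\<Sum>v\<in>g ` I. u v *s v) = 0"
    using dependent_finite[of "g ` I"] I by auto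
  then have "(\<Sum>j\<in>I. u (g j) *s g j) = 0" using sum.reindex[OF True, of "\<lambda>v. u v *s v"] by simp
  then show ?thesis using that[of _ "u \<circ> g"] uv by auto
next
  case False
  then obtain i j where ij: "i \<in> I" "j \<in> I" "i \<noteq> j" "g i = g j" by (auto simp: inj_on_def)
  \<comment> \<open>A repeated vector is a relation by itself, with coefficients 1 and -1.\<close>
  define a where "a = (\<lambda>k. if k = i then 1 else if k = j then -1 else (0::'a))"
  have "(\<Sum>k\<in>I. a k *s g k) = (\<Sum>k\<in>{i, j}. a k *s g k)"
    using I ij by (intro sum.mono_neutral_right) (auto simp: a_def)
  also have "\<dots> = 0" using ij by (simp add: a_def)
  finally show ?thesis using that[of i a] ij by (simp add: a_def)
qed

end

context vector_space_pair
begin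

lemma dim_image_le_finite:
  assumes "Vector_Spaces.linear s1 s2 f" "finite X"
  shows "vs2.dim (f ` X) \<le> vs1.dim X"
proof -
  interpret Vector_Spaces.linear s1 s2 f by fact
  obtain B where B: "finite B" "X \<subseteq> vs1.span B" "card B = vs1.dim X"
    using vs1.obtain_finite_basis[OF assms(2)] by metis
  then have "f ` X \<subseteq> vs2.span (f ` B)" using span_image by blast
  then have "vs2.dim (f ` X) \<le> card (f ` B)" using vs2.dim_le_card B by blast
  then show ?thesis using B card_image_le[of B f] by simp
qed

text \<open>The rank bound for a block triangular arrangement. A basis of \<open>X\<close> is
  extended to one of the union; since \<open>f\<close> kills \<open>X\<close>, only the added
  vectors have images that matter for the image of \<open>Y\<close>.\<close>

lemma dim_add_dim_image_le:
  assumes f: "Vector_Spaces.linear s1 s2 f" and fin: "finite X" "finite Y" and ker: "\<And>x. x \<in> X \<Longrightarrow> f x = 0"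
  shows "vs1.dim X + vs2.dim (f ` Y) \<le> vs1.dim (X \<union> Y)"
proof -
  interpret Vector_Spaces.linear s1 s2 f by fact
  obtain BX where BX: "BX \<subseteq> X" "finite BX" "vs1.independent BX" "card BX = vs1.dim X"
    using vs1.obtain_finite_basis[OF fin(1)] by metis
  obtain B where B: "BX \<subseteq> B" "B \<subseteq> X \<union> Y" "vs1.independent B" "X \<union> Y \<subseteq> vs1.span B"
    using vs1.maximal_independent_subset_extend[of BX "X \<union> Y"] BX by blast
  have finB: "finite B" using B(2) fin finite_subset by blast
  have "f ` Y \<subseteq> vs2.span (f ` B)" using B(4) span_image by blast
  also have "f ` B \<subseteq> insert 0 (f ` (B - BX))" using ker BX(1) by auto
  then have "vs2.span (f ` B) \<subseteq> vs2.span (f ` (B - BX))"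
    using vs2.span_mono[of "f ` B"] vs2.span_insert_0 by metis
  finally have "vs2.dim (f ` Y) \<le> card (f ` (B - BX))" using vs2.dim_le_card finB by blast
  also have "\<dots> \<le> card (B - BX)" using card_image_le finB by blast
  also have "\<dots> = card B - card BX" using card_Diff_subset BX(2) B(1) by blast
  finally have "vs2.dim (f ` Y) \<le> card B - card BX" .
  moreover have "card BX \<le> card B" using B(1) finB card_mono by blast
  moreover have "card B = vs1.dim (X \<union> Y)" using vs1.basis_card_eq_dim B by blast
  ultimately show ?thesis using BX(4) by linarith
qed

end

section \<open>Functions as vectors, and matrix rank as a dimension\<close>

definition fscale :: "'f::field \<Rightarrow> ('r \<Rightarrow> 'f) \<Rightarrow> 'r \<Rightarrow> 'f" where
  "fscale a f = (\<lambda>r. a * f r)"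

lemma fscale_apply [simp]: "fscale a f r = a * f r"
  by (simp add: fscale_def)

global_interpretation fv: vector_space fscale
  by unfold_locales (auto simp: fun_eq_iff algebra_simps)

global_interpretation fvp: vector_space_pair fscale fscale
  by unfold_locales

lemma linear_fscaleI:
  assumes "\<And>v w. P (v + w) = P v + P w" "\<And>a v. P (fscale a v) = fscale a (P v)"
  shows "Vector_Spaces.linear fscale fscale P"
  using assms by unfold_locales auto

lemma sum_fun_apply: "sum g I r = (\<Sum>i\<in>I. g i r)"
  by (induction I rule: infinite_finite_induct) auto

text \<open>Padded by 0 below the last row, so that columns of matrices of any height are functions
  on \<open>nat\<close> and live in one space.\<close>

definition mcol :: "'f::field mat \<Rightarrow> nat \<Rightarrow> nat \<Rightarrow> 'f" where
  "mcol M c = (\<lambda>r. if r < dim_row M then M $$ (r, c) else 0)"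

text \<open>The injection \<open>\<phi>\<close> of \<open>carrier_vec n\<close> into functions
  preserves and reflects dependence of sets of columns. Hence a maximal independent set of columns,
  whose size is the rank, is mapped to a basis of the column set.\<close>

lemma mrank_eq_dim: "mrank M = fv.dim (mcol M ` {..<dim_col M})"
proof -
  define n where "n = dim_row M"
  interpret V: vec_space "TYPE('a)" n .
  define \<phi> where "\<phi> v = (\<lambda>r. if r < n then v $ r else (0::'a))" for v
  have inj: "inj_on \<phi> (carrier_vec n)"
  proof (rule inj_onI)
    fix v w :: "'a vec" assume vw: "v \<in> carrier_vec n" "w \<in> carrier_vec n" "\<phi> v = \<phi> w"
    have "v $ r = w $ r" if "r < n" for r
      using fun_cong[OF vw(3), of r] that by (simp add: \<phi>_def)
    then show "v = w" using vw by (intro eq_vecI) auto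
  qed
  have cols: "set (cols M) \<subseteq> carrier_vec n" using cols_dim n_def by blast
  have "\<phi> (col M c) = mcol M c" if "c < dim_col M" for c
    using that by (auto simp: \<phi>_def mcol_def n_def fun_eq_iff)
  then have img: "\<phi> ` set (cols M) = mcol M ` {..<dim_col M}"
    unfolding cols_def set_map image_image by (auto simp: atLeast0LessThan)
  have indep: "V.lin_indpt U \<longleftrightarrow> fv.independent (\<phi> ` U)" if U: "U \<subseteq> set (cols M)" for U
  proof -
    have fin: "finite U" and Uc: "U \<subseteq> carrier_vec n" using U cols finite_subset by auto
    have injU: "inj_on \<phi> U" using inj Uc inj_on_subset by blast
    have lc: "(\<Sum>v\<in>U. fscale (a v) (\<phi> v)) = \<phi> (V.lincomb a U)" for a
      by (auto simp: fun_eq_iff sum_fun_apply \<phi>_def V.lincomb_index[OF _ Uc])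
    have z: "\<phi> (V.lincomb a U) = 0 \<longleftrightarrow> V.lincomb a U = 0\<^sub>v n" for a
    proof -
      have "\<phi> (0\<^sub>v n) = 0" by (auto simp: \<phi>_def fun_eq_iff)
      moreover have "V.lincomb a U \<in> carrier_vec n" using V.lincomb_closed[OF Uc] by simp
      ultimately show ?thesis using inj_onD[OF inj, of "V.lincomb a U" "0\<^sub>v n"] by fastforce
    qed
    have "fv.dependent (\<phi> ` U) \<longleftrightarrow> (\<exists>u. (\<exists>v\<in>\<phi> ` U. u v \<noteq> 0) \<and> (\<Sum>v\<in>\<phi> ` U. fscale (u v) v) = 0)"
      by (rule fv.dependent_finite) (use fin in simp)
    also have "\<dots> \<longleftrightarrow> (\<exists>a. (\<exists>v\<in>U. a v \<noteq> 0) \<and> (\<Sum>v\<in>U. fscale (a v) (\<phi> v)) = 0)"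
    proof
      assume "\<exists>u. (\<exists>v\<in>\<phi> ` U. u v \<noteq> 0) \<and> (\<Sum>v\<in>\<phi> ` U. fscale (u v) v) = 0"
      then obtain u where "\<exists>v\<in>\<phi> ` U. u v \<noteq> 0" "(\<Sum>v\<in>\<phi> ` U. fscale (u v) v) = 0" by blast
      then show "\<exists>a. (\<exists>v\<in>U. a v \<noteq> 0) \<and> (\<Sum>v\<in>U. fscale (a v) (\<phi> v)) = 0"
        by (intro exI[of _ "u \<circ> \<phi>"]) (simp add: sum.reindex[OF injU])
    next
      assume "\<exists>a. (\<exists>v\<in>U. a v \<noteq> 0) \<and> (\<Sum>v\<in>U. fscale (a v) (\<phi> v)) = 0"
      then obtain a where "\<exists>v\<in>U. a v \<noteq> 0" "(\<Sum>v\<in>U. fscale (a v) (\<phi> v)) = 0" by blast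
      then show "\<exists>u. (\<exists>v\<in>\<phi> ` U. u v \<noteq> 0) \<and> (\<Sum>v\<in>\<phi> ` U. fscale (u v) v) = 0"
        by (intro exI[of _ "a \<circ> inv_into U \<phi>"])
          (simp add: sum.reindex[OF injU] inv_into_f_f[OF injU])
    qed
    also have "\<dots> \<longleftrightarrow> V.lin_dep U"
    proof
      assume "\<exists>a. (\<exists>v\<in>U. a v \<noteq> 0) \<and> (\<Sum>v\<in>U. fscale (a v) (\<phi> v)) = 0"
      then show "V.lin_dep U" using V.lin_dep_crit[OF fin] unfolding lc z by blast
    next
      assume "V.lin_dep U"
      from V.finite_lin_dep[OF fin this Uc]
      show "\<exists>a. (\<exists>v\<in>U. a v \<noteq> 0) \<and> (\<Sum>v\<in>U. fscale (a v) (\<phi> v)) = 0" unfolding lc z by blast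
    qed
    finally show ?thesis by blast
  qed
  have "V.lin_indpt {}" using indep[of "{}"] fv.independent_empty by simp
  then obtain S where S: "maximal S (\<lambda>T. T \<subseteq> set (cols M) \<and> V.lin_indpt T)"
    using maximal_exists_superset[of "set (cols M)" "\<lambda>T. T \<subseteq> set (cols M) \<and> V.lin_indpt T" "{}"]
    by blast
  have S': "S \<subseteq> set (cols M)" "fv.independent (\<phi> ` S)"
    using S indep unfolding maximal_def by auto
  have "\<phi> ` set (cols M) \<subseteq> fv.span (\<phi> ` S)"
  proof
    fix w assume "w \<in> \<phi> ` set (cols M)"
    then obtain v where v: "v \<in> set (cols M)" "w = \<phi> v" by blast
    show "w \<in> fv.span (\<phi> ` S)"
    proof (rule ccontr)
      assume w: "w \<notin> fv.span (\<phi> ` S)"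
      then have "fv.independent (\<phi> ` insert v S)"
        using fv.independent_insertI S' v by simp
      then have "V.lin_indpt (insert v S)" using indep S' v by auto
      then have "insert v S = S" using S S'(1) v unfolding maximal_def by blast
      then have "v \<in> S" by blast
      then show False using w v fv.span_base by blast
    qed
  qed
  then have "card (\<phi> ` S) = fv.dim (\<phi> ` set (cols M))"
    using fv.basis_card_eq_dim[of "\<phi> ` S" "\<phi> ` set (cols M)"] S' by blast
  moreover have "card (\<phi> ` S) = card S"
    by (rule card_image) (use inj S'(1) cols in \<open>auto intro: inj_on_subset\<close>)
  moreover have "mrank M = card S"
    unfolding mrank_def n_def[symmetric] using V.rank_card_indpt[OF _ S] n_def by blast
  ultimately show ?thesis using img by simp
qed

subsection \<open>Test matrices as sets of columns\<close>

text \<open>Reading row \<open>\<rho> r\<close> in place of row \<open>r\<close> and erasing the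
  rows outside \<open>R\<close> is a linear map, even if \<open>\<rho>\<close> repeats or drops
  rows. Every comparison between different row labels goes through this bound.\<close>

lemma dim_le_row_pullback:
  fixes X :: "('r \<Rightarrow> 'f::field) set" and X' :: "('q \<Rightarrow> 'f) set"
  assumes "finite X" and "\<And>x'. x' \<in> X' \<Longrightarrow> \<exists>x\<in>X. \<forall>r. x' r = (if r \<in> R then x (\<rho> r) else 0)"
  shows "fv.dim X' \<le> fv.dim X"
proof -
  define P where "P w = (\<lambda>r. if r \<in> R then w (\<rho> r) else 0)" for w :: "'r \<Rightarrow> 'f"
  have lin: "Vector_Spaces.linear fscale fscale P"
    by (rule linear_fscaleI) (auto simp: P_def fun_eq_iff)
  have "X' \<subseteq> P ` X"
  proof
    fix x' assume "x' \<in> X'"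
    from assms(2)[OF this] obtain x where "x \<in> X" "x' = P x" by (auto simp: P_def fun_eq_iff)
    then show "x' \<in> P ` X" by blast
  qed
  then have "fv.dim X' \<le> fv.dim (P ` X)" using assms(1) by (intro fv.dim_subset_finite) auto
  then show ?thesis using fvp.dim_image_le_finite[OF lin assms(1)] by linarith
qed

section \<open>Rows and columns of concatenated matrices\<close>

lemma dim_hcat [simp]: "dim_row (hcat M1 M2) = dim_row M1" "dim_col (hcat M1 M2) = dim_col M1 + dim_col M2"
  by (simp_all add: hcat_def)

lemma dim_vcat [simp]: "dim_row (vcat M1 M2) = dim_row M1 + dim_row M2" "dim_col (vcat M1 M2) = dim_col M1"
  by (simp_all add: vcat_def)

lemma hcat_list_simps [simp]:
  "hcat_list r [] = 0\<^sub>m r 0" "hcat_list r (M # Ms) = hcat M (hcat_list r Ms)"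
  by (simp_all add: hcat_list_def)

lemma vcat_list_simps [simp]:
  "vcat_list c [] = 0\<^sub>m 0 c" "vcat_list c (M # Ms) = vcat M (vcat_list c Ms)"
  by (simp_all add: vcat_list_def)

lemma dim_row_hcat_list: "\<forall>M\<in>set Ms. dim_row M = r \<Longrightarrow> dim_row (hcat_list r Ms) = r"
  by (cases Ms) auto

lemma dim_col_vcat_list: "\<forall>M\<in>set Ms. dim_col M = c \<Longrightarrow> dim_col (vcat_list c Ms) = c"
  by (cases Ms) auto

text \<open>Only the existence of a source block is recorded and never its position, which is enough
  for sets of columns. The following three lemmas have the same purpose.\<close>

lemma hcat_list_colE:
  assumes "\<forall>M\<in>set Ms. dim_row M = r" "q < dim_col (hcat_list r Ms)"
  obtains M c where "M \<in> set Ms" "c < dim_col M" "\<forall>p<r. hcat_list r Ms $$ (p, q) = M $$ (p, c)"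
proof -
  have "\<exists>M\<in>set Ms. \<exists>c<dim_col M. \<forall>p<r. hcat_list r Ms $$ (p, q) = M $$ (p, c)"
    using assms
  proof (induction Ms arbitrary: q)
    case (Cons M Ms)
    show ?case
    proof (cases "q < dim_col M")
      case True
      then show ?thesis using Cons.prems by (auto simp: hcat_def)
    next
      case False
      then have "q - dim_col M < dim_col (hcat_list r Ms)" using Cons.prems by auto
      from Cons.IH[OF _ this] obtain M' c where
        M': "M' \<in> set Ms" "c < dim_col M'" "\<forall>p<r. hcat_list r Ms $$ (p, q - dim_col M) = M' $$ (p, c)"
        using Cons.prems(1) by auto
      then have "\<forall>p<r. hcat_list r (M # Ms) $$ (p, q) = M' $$ (p, c)"
        using Cons.prems False by (auto simp: hcat_def)
      then show ?thesis using M' by auto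
    qed
  qed auto
  then show ?thesis using that by blast
qed

lemma hcat_list_col_ex:
  assumes "\<forall>M\<in>set Ms. dim_row M = r" "M \<in> set Ms" "c < dim_col M"
  shows "\<exists>q<dim_col (hcat_list r Ms). \<forall>p<r. hcat_list r Ms $$ (p, q) = M $$ (p, c)"
  using assms
proof (induction Ms)
  case (Cons M' Ms)
  show ?case
  proof (cases "M = M'")
    case True
    then show ?thesis using Cons.prems by (intro exI[of _ c]) (auto simp: hcat_def)
  next
    case False
    then obtain q where q: "q < dim_col (hcat_list r Ms)" "\<forall>p<r. hcat_list r Ms $$ (p, q) = M $$ (p, c)"
      using Cons by auto
    then show ?thesis using Cons.prems by (intro exI[of _ "dim_col M' + q"]) (auto simp: hcat_def)
  qed
qed auto

lemma vcat_list_rowE: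
  assumes "\<forall>M\<in>set Ms. dim_col M = c" "q < dim_row (vcat_list c Ms)"
  obtains M l where "M \<in> set Ms" "l < dim_row M" "\<forall>p<c. vcat_list c Ms $$ (q, p) = M $$ (l, p)"
proof -
  have "\<exists>M\<in>set Ms. \<exists>l<dim_row M. \<forall>p<c. vcat_list c Ms $$ (q, p) = M $$ (l, p)"
    using assms
  proof (induction Ms arbitrary: q)
    case (Cons M Ms)
    show ?case
    proof (cases "q < dim_row M")
      case True
      then show ?thesis using Cons.prems by (auto simp: vcat_def)
    next
      case False
      then have "q - dim_row M < dim_row (vcat_list c Ms)" using Cons.prems by auto
      from Cons.IH[OF _ this] obtain M' l where
        M': "M' \<in> set Ms" "l < dim_row M'" "\<forall>p<c. vcat_list c Ms $$ (q - dim_row M, p) = M' $$ (l, p)"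
        using Cons.prems(1) by auto
      then have "\<forall>p<c. vcat_list c (M # Ms) $$ (q, p) = M' $$ (l, p)"
        using Cons.prems False by (auto simp: vcat_def)
      then show ?thesis using M' by auto
    qed
  qed auto
  then show ?thesis using that by blast
qed

lemma vcat_list_row_ex:
  assumes "\<forall>M\<in>set Ms. dim_col M = c" "M \<in> set Ms" "l < dim_row M"
  shows "\<exists>q<dim_row (vcat_list c Ms). \<forall>p<c. vcat_list c Ms $$ (q, p) = M $$ (l, p)"
  using assms
proof (induction Ms)
  case (Cons M' Ms)
  show ?case
  proof (cases "M = M'")
    case True
    then show ?thesis using Cons.prems by (intro exI[of _ l]) (auto simp: vcat_def)
  next
    case False
    then obtain q where q: "q < dim_row (vcat_list c Ms)" "\<forall>p<c. vcat_list c Ms $$ (q, p) = M $$ (l, p)"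
      using Cons by auto
    then show ?thesis using Cons.prems by (intro exI[of _ "dim_row M' + q"]) (auto simp: vcat_def)
  qed
qed auto

text \<open>Row \<open>Inl p\<close> is a state equation and row \<open>Inr (i, b)\<close> is output
  \<open>b\<close> of channel \<open>i\<close>. Outputs of channels in \<open>s\<close> are set to 0
  instead of being removed, so the columns for all \<open>s\<close>, and those of the extended
  system, share one space.\<close>

definition state_col :: "nat \<Rightarrow> real mat \<Rightarrow> (nat \<Rightarrow> real mat) \<Rightarrow> nat set \<Rightarrow> complex \<Rightarrow> nat
    \<Rightarrow> nat + nat \<times> nat \<Rightarrow> complex" where
  "state_col m A C s lam c r = (case r of
     Inl p \<Rightarrow> if p < dim_row A then (if p = c then lam else 0) - complex_of_real (A $$ (p, c)) else 0
   | Inr (i, b) \<Rightarrow> if i < m \<and> i \<notin> s \<and> b < dim_row (C i) then complex_of_real (C i $$ (b, c)) else 0)"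

definition input_col :: "nat \<Rightarrow> (nat \<Rightarrow> real mat) \<Rightarrow> nat \<times> nat \<Rightarrow> nat + nat \<times> nat \<Rightarrow> complex" where
  "input_col n B ia r = (case r of
     Inl p \<Rightarrow> if p < n then complex_of_real (B (fst ia) $$ (p, snd ia)) else 0
   | Inr _ \<Rightarrow> 0)"

definition sys_cols :: "nat \<Rightarrow> real mat \<Rightarrow> (nat \<Rightarrow> real mat) \<Rightarrow> (nat \<Rightarrow> real mat) \<Rightarrow> nat set
    \<Rightarrow> complex \<Rightarrow> (nat + nat \<times> nat \<Rightarrow> complex) set" where
  "sys_cols m A B C s lam = state_col m A C s lam ` {..<dim_row A} \<union>
     input_col (dim_row A) B ` (SIGMA i:s. {..<dim_col (B i)})"

lemma finite_sys_cols: "finite s \<Longrightarrow> finite (sys_cols m A B C s lam)"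
  by (simp add: sys_cols_def)

text \<open>Each column set is a row pullback of the other, so neither dimension exceeds the other;
  order and repetition of columns do not matter to the dimension of a set.\<close>

lemma mrank_test_mat:
  assumes A: "A \<in> carrier_mat n n" and B: "\<forall>i<m. dim_row (B i) = n" and C: "\<forall>i<m. dim_col (C i) = n"
    and s: "s \<subseteq> {0..<m}"
  shows "mrank (test_mat m A B C s lam) = fv.dim (sys_cols m A B C s lam)"
proof -
  define T where "T = test_mat m A B C s lam"
  define Bs where "Bs = B_sub n B s"
  define Cs where "Cs = C_sub n C ({0..<m} - s)"
  have fin: "finite s" using s finite_subset by blast
  have An: "dim_row A = n" "dim_col A = n" using A by auto
  have Bi: "\<forall>M\<in>set (map B (sorted_list_of_set s)). dim_row M = n"
    using B s fin by auto
  have Ci: "\<forall>M\<in>set (map C (sorted_list_of_set ({0..<m} - s))). dim_col M = n"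
    using C by auto
  have dB: "dim_row Bs = n" unfolding Bs_def B_sub_def by (rule dim_row_hcat_list) (rule Bi)
  have dC: "dim_col Cs = n" unfolding Cs_def C_sub_def by (rule dim_col_vcat_list) (rule Ci)
  have T: "T = four_block_mat (lam \<cdot>\<^sub>m 1\<^sub>m n - map_mat complex_of_real A) (map_mat complex_of_real Bs)
                     (map_mat complex_of_real Cs) (0\<^sub>m (dim_row Cs) (dim_col Bs))"
    by (simp add: T_def test_mat_def Let_def An Bs_def Cs_def)
  have dT: "dim_row T = n + dim_row Cs" "dim_col T = n + dim_col Bs" by (simp_all add: T An)
  have T1: "T $$ (r, c) = (if r = c then lam else 0) - complex_of_real (A $$ (r, c))" if "r < n" "c < n" for r c
    using that An by (simp add: T)
  have T2: "T $$ (r, n + q) = complex_of_real (Bs $$ (r, q))" if "r < n" "q < dim_col Bs" for r q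
    using that An dB by (simp add: T)
  have T3: "T $$ (n + r, c) = complex_of_real (Cs $$ (r, c))" if "r < dim_row Cs" "c < n" for r c
    using that An dC by (simp add: T)
  have T4: "T $$ (n + r, n + q) = 0" if "r < dim_row Cs" "q < dim_col Bs" for r q
    using that An dB dC by (simp add: T)
  have B1: "\<exists>i\<in>s. \<exists>a<dim_col (B i). \<forall>p<n. Bs $$ (p, q) = B i $$ (p, a)" if q: "q < dim_col Bs" for q
  proof -
    obtain M a where M: "M \<in> set (map B (sorted_list_of_set s))" "a < dim_col M" "\<forall>p<n. Bs $$ (p, q) = M $$ (p, a)"
      using hcat_list_colE[OF Bi] q unfolding Bs_def B_sub_def by metis
    then show ?thesis using fin by auto
  qed
  have B2: "\<exists>q<dim_col Bs. \<forall>p<n. Bs $$ (p, q) = B i $$ (p, a)" if "i \<in> s" "a < dim_col (B i)" for i a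
    using hcat_list_col_ex[OF Bi, of "B i" a] that fin unfolding Bs_def B_sub_def by auto
  have C1: "\<exists>i b. i \<in> {0..<m} - s \<and> b < dim_row (C i) \<and> (\<forall>p<n. Cs $$ (q, p) = C i $$ (b, p))"
    if q: "q < dim_row Cs" for q
  proof -
    obtain M b where M: "M \<in> set (map C (sorted_list_of_set ({0..<m} - s)))" "b < dim_row M" "\<forall>p<n. Cs $$ (q, p) = M $$ (b, p)"
      using vcat_list_rowE[OF Ci] q unfolding Cs_def C_sub_def by metis
    then obtain i where "i \<in> {0..<m} - s" "M = C i" by auto
    with M show ?thesis by blast
  qed
  have C2: "\<exists>q<dim_row Cs. \<forall>p<n. Cs $$ (q, p) = C i $$ (b, p)" if "i \<in> {0..<m} - s" "b < dim_row (C i)" for i b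
    using vcat_list_row_ex[OF Ci, of "C i" b] that unfolding Cs_def C_sub_def by auto
  have "fv.dim (mcol T ` {..<dim_col T}) \<le> fv.dim (sys_cols m A B C s lam)"
  proof -
    \<comment> \<open>\<open>I q\<close> and \<open>b q\<close> name the channel and the output
      behind row \<open>q\<close> of the stacked matrix.\<close>
    obtain I b where Ib: "\<And>q. q < dim_row Cs \<Longrightarrow> I q \<in> {0..<m} - s \<and> b q < dim_row (C (I q)) \<and>
        (\<forall>p<n. Cs $$ (q, p) = C (I q) $$ (b q, p))"
      using C1 by metis
    show ?thesis
    proof (rule dim_le_row_pullback[where R = "{..<dim_row T}" and
          \<rho> = "\<lambda>r. if r < n then Inl r else Inr (I (r - n), b (r - n))"])
      fix x' assume "x' \<in> mcol T ` {..<dim_col T}"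
      then obtain c where c: "c < dim_col T" "x' = mcol T c" by blast
      show "\<exists>x\<in>sys_cols m A B C s lam. \<forall>r. x' r =
        (if r \<in> {..<dim_row T} then x (if r < n then Inl r else Inr (I (r - n), b (r - n))) else 0)"
      proof (cases "c < n")
        case True
        have "x' r = (if r \<in> {..<dim_row T} then
            state_col m A C s lam c (if r < n then Inl r else Inr (I (r - n), b (r - n))) else 0)" for r
          using Ib[of "r - n"] T1[OF _ True, of r] T3[OF _ True, of "r - n"] True
          by (auto simp: c mcol_def state_col_def An dT)
        then show ?thesis using True An by (auto simp: sys_cols_def)
      next
        case False
        then have q: "c - n < dim_col Bs" using c dT by auto
        then obtain i a where ia: "i \<in> s" "a < dim_col (B i)" "\<forall>p<n. Bs $$ (p, c - n) = B i $$ (p, a)"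
          using B1 by blast
        have "x' r = (if r \<in> {..<dim_row T} then
            input_col n B (i, a) (if r < n then Inl r else Inr (I (r - n), b (r - n))) else 0)" for r
          using T2[OF _ q, of r] T4[OF _ q, of "r - n"] False ia
          by (auto simp: c mcol_def input_col_def dT)
        then show ?thesis using ia An by (intro bexI[of _ "input_col n B (i, a)"]) (auto simp: sys_cols_def)
      qed
    qed (rule finite_sys_cols[OF fin])
  qed
  moreover have "fv.dim (sys_cols m A B C s lam) \<le> fv.dim (mcol T ` {..<dim_col T})"
  proof -
    \<comment> \<open>Conversely, \<open>q i b\<close> is some position at which output
      \<open>b\<close> of channel \<open>i\<close> is stacked.\<close>
    obtain q where q: "\<And>i b. i \<in> {0..<m} - s \<Longrightarrow> b < dim_row (C i) \<Longrightarrow>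
        q i b < dim_row Cs \<and> (\<forall>p<n. Cs $$ (q i b, p) = C i $$ (b, p))"
      using C2 by metis
    define \<rho> :: "nat + nat \<times> nat \<Rightarrow> nat" where "\<rho> = case_sum id (\<lambda>(i, b). n + q i b)"
    define R where "R = (Inl ` {..<n} \<union> Inr ` (SIGMA i:{0..<m} - s. {..<dim_row (C i)}) :: (nat + nat \<times> nat) set)"
    show ?thesis
    proof (rule dim_le_row_pullback[where R = R and \<rho> = \<rho>])
      fix x' assume "x' \<in> sys_cols m A B C s lam"
      then consider c where "c < n" "x' = state_col m A C s lam c"
        | i a where "i \<in> s" "a < dim_col (B i)" "x' = input_col n B (i, a)"
        by (auto simp: sys_cols_def An)
      then show "\<exists>x\<in>mcol T ` {..<dim_col T}. \<forall>r. x' r = (if r \<in> R then x (\<rho> r) else 0)"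
      proof cases
        case 1
        have "x' r = (if r \<in> R then mcol T c (\<rho> r) else 0)" for r
        proof (cases r)
          case (Inl p)
          then show ?thesis using 1 T1[of p c] by (auto simp: R_def \<rho>_def mcol_def dT state_col_def An)
        next
          case (Inr ib)
          then obtain i b where r: "r = Inr (i, b)" by (cases ib) auto
          show ?thesis using 1 q[of i b] T3[of "q i b" c]
            by (auto simp: r R_def \<rho>_def mcol_def dT state_col_def)
        qed
        then show ?thesis using 1 dT by (intro bexI[of _ "mcol T c"]) auto
      next
        case 2
        obtain k where k: "k < dim_col Bs" "\<forall>p<n. Bs $$ (p, k) = B i $$ (p, a)" using B2 2 by blast
        have "x' r = (if r \<in> R then mcol T (n + k) (\<rho> r) else 0)" for r
        proof (cases r)
          case (Inl p)
          then show ?thesis using 2 k T2[of p k] by (auto simp: R_def \<rho>_def mcol_def dT input_col_def)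
        next
          case (Inr ib)
          then obtain i b where r: "r = Inr (i, b)" by (cases ib) auto
          show ?thesis using 2 q[of i b] k T4[of "q i b" k]
            by (auto simp: r R_def \<rho>_def mcol_def dT input_col_def)
        qed
        then show ?thesis using k dT by (intro bexI[of _ "mcol T (n + k)"]) auto
      qed
    qed simp
  qed
  ultimately show ?thesis unfolding mrank_eq_dim T_def by simp
qed

section \<open>Closed-loop matrices and their eigenvalues, entry by entry\<close>

lemma foldr_add_mat:
  assumes "\<forall>i\<in>set L. G i \<in> carrier_mat nr nc" "Z \<in> carrier_mat nr nc"
  shows "foldr (\<lambda>i (M :: 'a::comm_monoid_add mat). G i + M) L Z \<in> carrier_mat nr nc \<and>
    (\<forall>p<nr. \<forall>c<nc. foldr (\<lambda>i M. G i + M) L Z $$ (p, c) = (\<Sum>i\<leftarrow>L. G i $$ (p, c)) + Z $$ (p, c))"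
  using assms
proof (induction L)
  case (Cons i L)
  then have "G i \<in> carrier_mat nr nc" by simp
  with Cons show ?case by (auto simp: add.assoc)
qed auto

lemma feedback_mat_entry:
  assumes A: "A \<in> carrier_mat n n" and B: "\<forall>i<m. dim_row (B i) = n" and C: "\<forall>i<m. dim_col (C i) = n"
    and F: "\<forall>i<m. F i \<in> carrier_mat (dim_col (B i)) (dim_row (C i))"
  shows "feedback_mat m A B C F \<in> carrier_mat n n"
    and "p < n \<Longrightarrow> c < n \<Longrightarrow> feedback_mat m A B C F $$ (p, c) = A $$ (p, c) +
      (\<Sum>i<m. \<Sum>a<dim_col (B i). \<Sum>b<dim_row (C i). B i $$ (p, a) * F i $$ (a, b) * C i $$ (b, c))"
proof -
  have G: "\<forall>i\<in>set [0..<m]. B i * F i * C i \<in> carrier_mat n n"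
    using B C F by auto
  have Z: "0\<^sub>m (dim_row A) (dim_col A) \<in> carrier_mat n n" using A by auto
  note fold = foldr_add_mat[OF G Z]
  show "feedback_mat m A B C F \<in> carrier_mat n n"
    using A fold by (auto simp: feedback_mat_def)
  assume pc: "p < n" "c < n"
  have "(B i * F i * C i) $$ (p, c) =
      (\<Sum>a<dim_col (B i). \<Sum>b<dim_row (C i). B i $$ (p, a) * F i $$ (a, b) * C i $$ (b, c))" if i: "i < m" for i
  proof -
    have dims: "dim_row (B i) = n" "dim_col (C i) = n" "dim_row (F i) = dim_col (B i)" "dim_col (F i) = dim_row (C i)"
      using i B C F by auto
    have BF: "(B i * F i) $$ (p, b) = (\<Sum>a<dim_col (B i). B i $$ (p, a) * F i $$ (a, b))"
      if "b < dim_row (C i)" for b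
      using that dims pc by (simp add: scalar_prod_def lessThan_atLeast0)
    have "(B i * F i * C i) $$ (p, c) = (\<Sum>b<dim_row (C i). (B i * F i) $$ (p, b) * C i $$ (b, c))"
      using dims pc by (simp add: scalar_prod_def lessThan_atLeast0)
    also have "\<dots> = (\<Sum>b<dim_row (C i). \<Sum>a<dim_col (B i). B i $$ (p, a) * F i $$ (a, b) * C i $$ (b, c))"
      by (rule sum.cong) (simp_all add: BF sum_distrib_right)
    finally show ?thesis by (subst sum.swap)
  qed
  then have "(\<Sum>i\<leftarrow>[0..<m]. (B i * F i * C i) $$ (p, c)) =
      (\<Sum>i<m. \<Sum>a<dim_col (B i). \<Sum>b<dim_row (C i). B i $$ (p, a) * F i $$ (a, b) * C i $$ (b, c))"
    by (simp add: interv_sum_list_conv_sum_set_nat lessThan_atLeast0)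
  then show "feedback_mat m A B C F $$ (p, c) = A $$ (p, c) +
      (\<Sum>i<m. \<Sum>a<dim_col (B i). \<Sum>b<dim_row (C i). B i $$ (p, a) * F i $$ (a, b) * C i $$ (b, c))"
    using A fold pc by (auto simp: feedback_mat_def)
qed

text \<open>The eigenvector becomes the coefficients of a linear relation between the columns of
  lambda I - M, the form in which it meets the dimension arguments.\<close>

lemma eigenvalue_iff_sum:
  fixes M :: "'a::field mat"
  assumes M: "M \<in> carrier_mat n n"
  shows "eigenvalue M lam \<longleftrightarrow>
    (\<exists>x. (\<exists>c<n. x c \<noteq> 0) \<and> (\<forall>p<n. (\<Sum>c<n. x c * ((if p = c then lam else 0) - M $$ (p, c))) = 0))"
proof -
  have eq: "(\<Sum>c<n. x c * ((if p = c then lam else 0) - M $$ (p, c))) = lam * x p - (M *\<^sub>v vec n x) $ p"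
    if "p < n" for p x
  proof -
    have "(\<Sum>c<n. x c * ((if p = c then lam else 0) - M $$ (p, c))) =
        (\<Sum>c<n. if p = c then lam * x c else 0) - (\<Sum>c<n. M $$ (p, c) * x c)"
      unfolding sum_subtractf[symmetric] by (rule sum.cong) (auto simp: algebra_simps)
    then show ?thesis using that M by (simp add: scalar_prod_def lessThan_atLeast0)
  qed
  show ?thesis
  proof
    assume "eigenvalue M lam"
    then obtain v where v: "v \<in> carrier_vec n" "v \<noteq> 0\<^sub>v n" "M *\<^sub>v v = lam \<cdot>\<^sub>v v"
      using M by (auto simp: eigenvalue_def eigenvector_def)
    have "vec n (\<lambda>c. v $ c) = v" using v by auto
    then have "\<forall>p<n. (\<Sum>c<n. v $ c * ((if p = c then lam else 0) - M $$ (p, c))) = 0"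
      using eq[of _ "\<lambda>c. v $ c"] v by auto
    moreover have "\<exists>c<n. v $ c \<noteq> 0" using v by (metis carrier_vecD eq_vecI index_zero_vec(1) index_zero_vec(2))
    ultimately show "\<exists>x. (\<exists>c<n. x c \<noteq> 0) \<and> (\<forall>p<n. (\<Sum>c<n. x c * ((if p = c then lam else 0) - M $$ (p, c))) = 0)"
      by (intro exI[of _ "\<lambda>c. v $ c"] conjI)
  next
    assume "\<exists>x. (\<exists>c<n. x c \<noteq> 0) \<and> (\<forall>p<n. (\<Sum>c<n. x c * ((if p = c then lam else 0) - M $$ (p, c))) = 0)"
    then obtain x c where x: "c < n" "x c \<noteq> 0"
      "\<forall>p<n. (\<Sum>c<n. x c * ((if p = c then lam else 0) - M $$ (p, c))) = 0" by blast
    have "M *\<^sub>v vec n x = lam \<cdot>\<^sub>v vec n x"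
      using x(3) eq M by (intro eq_vecI) auto
    moreover have "vec n x \<noteq> 0\<^sub>v n" using x(1,2) by (metis index_vec index_zero_vec(1))
    ultimately show "eigenvalue M lam"
      using M unfolding eigenvalue_def eigenvector_def by (intro exI[of _ "vec n x"]) auto
  qed
qed

lemma closed_loop_eigenvalue_iff:
  assumes A: "A \<in> carrier_mat n n" and B: "\<forall>i<m. dim_row (B i) = n" and C: "\<forall>i<m. dim_col (C i) = n"
    and F: "\<forall>i<m. F i \<in> carrier_mat (dim_col (B i)) (dim_row (C i))"
  shows "eigenvalue (map_mat complex_of_real (feedback_mat m A B C F)) lam \<longleftrightarrow>
    (\<exists>x. (\<exists>c<n. x c \<noteq> 0) \<and> (\<forall>p<n. (\<Sum>c<n. x c * ((if p = c then lam else 0) - complex_of_real (A $$ (p, c)) -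
       (\<Sum>i<m. \<Sum>a<dim_col (B i). \<Sum>b<dim_row (C i).
          complex_of_real (B i $$ (p, a)) * complex_of_real (F i $$ (a, b)) * complex_of_real (C i $$ (b, c))))) = 0))"
proof -
  define M where "M = map_mat complex_of_real (feedback_mat m A B C F)"
  note fb = feedback_mat_entry[OF A B C F]
  have "M \<in> carrier_mat n n" using fb(1) by (simp add: M_def)
  note ev = eigenvalue_iff_sum[OF this, of lam]
  have "M $$ (p, c) = complex_of_real (A $$ (p, c)) +
       (\<Sum>i<m. \<Sum>a<dim_col (B i). \<Sum>b<dim_row (C i).
          complex_of_real (B i $$ (p, a)) * complex_of_real (F i $$ (a, b)) * complex_of_real (C i $$ (b, c)))"
    if "p < n" "c < n" for p c
    using that fb(1) fb(2)[OF that] by (simp add: M_def)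
  then show ?thesis unfolding M_def[symmetric] ev by (simp add: diff_diff_eq cong: sum.cong_simp)
qed

subsection \<open>Fixed eigenvalues\<close>

text \<open>Output feedback acts on the test matrix by elementary operations: the feedback of a
  channel in \<open>s\<close> subtracts multiples of its input columns, that of a channel outside
  \<open>s\<close> subtracts multiples of its output rows. What is left in the state rows is lambda
  I minus the closed-loop matrix, so its rank stays below \<open>n\<close> for every
  \<open>F\<close>.\<close>

lemma fixed_eigenvalue_if_rank_less:
  assumes A: "A \<in> carrier_mat n n" and B: "\<forall>i<m. dim_row (B i) = n" and C: "\<forall>i<m. dim_col (C i) = n"
    and s: "s \<subseteq> {0..<m}" and less: "fv.dim (sys_cols m A B C s lam) < n"
  shows "fixed_eigenvalue m A B C lam"
  unfolding fixed_eigenvalue_def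
proof (intro allI impI)
  fix F :: "nat \<Rightarrow> real mat" assume F: "\<forall>i<m. F i \<in> carrier_mat (dim_col (B i)) (dim_row (C i))"
  have fin: "finite s" using s finite_subset by blast
  have An: "dim_row A = n" using A by auto
  define X where "X = sys_cols m A B C s lam"
  have finX: "finite X" unfolding X_def by (rule finite_sys_cols[OF fin])
  define G where "G i p c = (\<Sum>a<dim_col (B i). \<Sum>b<dim_row (C i).
      complex_of_real (B i $$ (p, a)) * complex_of_real (F i $$ (a, b)) * complex_of_real (C i $$ (b, c)))" for i p c
  define g where "g c p = (if p < n then (if p = c then lam else 0) - complex_of_real (A $$ (p, c)) -
      (\<Sum>i<m. G i p c) else 0)" for c p
  \<comment> \<open>This is the row operation, for the channels outside \<open>s\<close>;
    \<open>h\<close> below is the column operation, for the channels in \<open>s\<close>.\<close>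
  define P where "P w p = (if p < n then w (Inl p) - (\<Sum>i\<in>{..<m} - s. \<Sum>a<dim_col (B i). \<Sum>b<dim_row (C i).
      complex_of_real (B i $$ (p, a)) * complex_of_real (F i $$ (a, b)) * w (Inr (i, b))) else 0)"
    for w :: "nat + nat \<times> nat \<Rightarrow> complex" and p
  define h where "h c = state_col m A C s lam c - (\<Sum>i\<in>s. \<Sum>a<dim_col (B i).
      fscale (\<Sum>b<dim_row (C i). complex_of_real (F i $$ (a, b)) * complex_of_real (C i $$ (b, c)))
        (input_col n B (i, a)))" for c
  have lin: "Vector_Spaces.linear fscale fscale P"
    by (rule linear_fscaleI)
      (auto simp: P_def fun_eq_iff sum.distrib algebra_simps sum_distrib_left)
  interpret P: Vector_Spaces.linear fscale fscale P by (rule lin)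
  have h: "h c \<in> fv.span X" if "c < n" for c
    unfolding h_def X_def
    by (intro fv.span_diff fv.span_sum fv.span_scale fv.span_base)
      (use that in \<open>auto simp: sys_cols_def An\<close>)
  have Ph: "P (h c) = g c" if c: "c < n" for c
  proof
    fix p
    show "P (h c) p = g c p"
    proof (cases "p < n")
      case True
      have 1: "h c (Inl p) = (if p = c then lam else 0) - complex_of_real (A $$ (p, c)) - (\<Sum>i\<in>s. G i p c)"
        using True by (simp add: h_def state_col_def input_col_def An sum_fun_apply G_def sum_distrib_left mult_ac)
      \<comment> \<open>Input columns vanish on output rows, so the column operation leaves these
        rows intact for the row operation.\<close>
      have 2: "h c (Inr (i, b)) = complex_of_real (C i $$ (b, c))" if "i \<in> {..<m} - s" "b < dim_row (C i)" for i b
        using that by (simp add: h_def state_col_def input_col_def sum_fun_apply)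
      have "P (h c) p = h c (Inl p) - (\<Sum>i\<in>{..<m} - s. G i p c)"
        using True by (simp add: P_def G_def 2 cong: sum.cong_simp)
      moreover have "(\<Sum>i<m. G i p c) = (\<Sum>i\<in>s. G i p c) + (\<Sum>i\<in>{..<m} - s. G i p c)"
        using s by (subst sum.subset_diff[of s]) (auto simp: lessThan_atLeast0)
      ultimately show ?thesis using True by (simp add: 1 g_def)
    qed (simp add: P_def g_def)
  qed
  have "g ` {..<n} \<subseteq> P ` fv.span X" using h Ph[symmetric] by auto
  then have "g ` {..<n} \<subseteq> fv.span (P ` X)" by (simp add: P.span_image)
  then have "fv.dim (g ` {..<n}) \<le> fv.dim (P ` X)" using finX by (intro fv.dim_mono_finite) auto
  also have "\<dots> \<le> fv.dim X" by (rule fvp.dim_image_le_finite[OF lin finX])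
  finally have "fv.dim (g ` {..<n}) < card {..<n}" using less by (simp add: X_def)
  then obtain x c where x: "c \<in> {..<n}" "x c \<noteq> 0" "(\<Sum>c<n. fscale (x c) (g c)) = 0"
    by (rule fv.dim_image_less_cardD[OF finite_lessThan])
  have gx: "(\<Sum>c<n. x c * g c p) = 0" for p
    using fun_cong[OF x(3), of p] by (simp add: sum_fun_apply)
  have "(\<Sum>c<n. x c * ((if p = c then lam else 0) - complex_of_real (A $$ (p, c)) - (\<Sum>i<m. G i p c))) = 0"
    if "p < n" for p
    using gx[of p] that by (simp add: g_def)
  then show "eigenvalue (map_mat complex_of_real (feedback_mat m A B C F)) lam"
    unfolding closed_loop_eigenvalue_iff[OF A B C F] G_def using x(1,2) by blast
qed

text \<open>The static gains needed are 0/1 matrices: the entries of all \<open>F i\<close> are independent scalar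
  gains on rank-one terms, and Rado's theorem selects which of them to switch on.\<close>

lemma rank_less_if_fixed_eigenvalue:
  assumes A: "A \<in> carrier_mat n n" and B: "\<forall>i<m. dim_row (B i) = n" and C: "\<forall>i<m. dim_col (C i) = n"
    and fixed: "fixed_eigenvalue m A B C lam"
  obtains s where "s \<subseteq> {0..<m}" "fv.dim (sys_cols m A B C s lam) < n"
proof -
  have An: "dim_row A = n" using A by auto
  define K where "K = (SIGMA i:{..<m}. {..<dim_col (B i)} \<times> {..<dim_row (C i)})"
  have finK: "finite K" by (simp add: K_def)
  define cf where "cf k c = complex_of_real (C (fst k) $$ (snd (snd k), c))" for k :: "nat \<times> nat \<times> nat" and c
  define bf where "bf k p = complex_of_real (B (fst k) $$ (p, fst (snd k)))" for k :: "nat \<times> nat \<times> nat" and p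
  \<comment> \<open>The extra coordinate \<open>Inr k\<close> holds the output entry of the triple
    \<open>k\<close>. Cancelling it against \<open>e k\<close> or \<open>y k\<close> forces the
    coefficient of that vector to be minus the output value, and with \<open>y k\<close> the same
    coefficient feeds the output back into the state rows.\<close>
  define w :: "nat \<Rightarrow> nat + nat \<times> nat \<times> nat \<Rightarrow> complex" where
    "w c = case_sum (\<lambda>p. if p < n then (if p = c then lam else 0) - complex_of_real (A $$ (p, c)) else 0)
       (\<lambda>k. if k \<in> K then cf k c else 0)" for c
  define e :: "nat \<times> nat \<times> nat \<Rightarrow> nat + nat \<times> nat \<times> nat \<Rightarrow> complex" where
    "e k r = (if r = Inr k then 1 else 0)" for k r
  define u :: "nat \<times> nat \<times> nat \<Rightarrow> nat + nat \<times> nat \<times> nat \<Rightarrow> complex" where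
    "u k = case_sum (\<lambda>p. if p < n then bf k p else 0) (\<lambda>_. 0)" for k
  define y where "y k = e k + u k" for k
  have "\<exists>S\<subseteq>K. fv.dim (w ` {..<n} \<union> e ` S \<union> y ` S) < n + card S"
  proof (rule fv.rado_pairs[OF finK])
    fix T assume T: "T \<subseteq> K"
    \<comment> \<open>Choosing \<open>y\<close> on \<open>T\<close> and \<open>e\<close> elsewhere
      is static feedback with gain 1 exactly on the triples in \<open>T\<close>.\<close>
    define F where "F i = mat (dim_col (B i)) (dim_row (C i))
      (\<lambda>(a, b). if (i, a, b) \<in> T then 1 else (0::real))" for i
    have F: "\<forall>i<m. F i \<in> carrier_mat (dim_col (B i)) (dim_row (C i))" by (simp add: F_def)
    have FT: "(\<Sum>i<m. \<Sum>a<dim_col (B i). \<Sum>b<dim_row (C i). complex_of_real (B i $$ (p, a)) *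
        complex_of_real (F i $$ (a, b)) * complex_of_real (C i $$ (b, c))) = (\<Sum>k\<in>T. bf k p * cf k c)" for p c
    proof -
      have "(\<Sum>i<m. \<Sum>a<dim_col (B i). \<Sum>b<dim_row (C i). complex_of_real (B i $$ (p, a)) *
          complex_of_real (F i $$ (a, b)) * complex_of_real (C i $$ (b, c))) =
          (\<Sum>i<m. \<Sum>ab\<in>{..<dim_col (B i)} \<times> {..<dim_row (C i)}. if (i, ab) \<in> T then bf (i, ab) p * cf (i, ab) c else 0)"
        by (intro sum.cong refl) (auto simp: sum.cartesian_product F_def bf_def cf_def intro!: sum.cong)
      also have "\<dots> = (\<Sum>k\<in>K. if k \<in> T then bf k p * cf k c else 0)"
        unfolding K_def by (subst sum.Sigma) (auto intro!: sum.cong)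
      also have "\<dots> = (\<Sum>k\<in>T. bf k p * cf k c)"
        using T finK by (simp add: sum.If_cases Int_absorb1)
      finally show ?thesis .
    qed
    obtain x c0 where x: "c0 < n" "x c0 \<noteq> 0" "\<forall>p<n. (\<Sum>c<n. x c * ((if p = c then lam else 0) -
        complex_of_real (A $$ (p, c)) - (\<Sum>k\<in>T. bf k p * cf k c))) = 0"
      using fixed F closed_loop_eigenvalue_iff[OF A B C F, of lam] unfolding fixed_eigenvalue_def FT by blast
    \<comment> \<open>The eigenvector \<open>x\<close>, extended by minus its output values
      \<open>V k\<close>, is a relation among the \<open>n + card K\<close> chosen vectors.\<close>
    define V where "V k = (\<Sum>c<n. x c * cf k c)" for k
    define h where "h = case_sum w (\<lambda>k. if k \<in> T then y k else e k)"
    define \<alpha> where "\<alpha> = case_sum x (\<lambda>k. - V k)"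
    have h: "h ` ({..<n} <+> K) = w ` {..<n} \<union> e ` (K - T) \<union> y ` T"
      using T by (auto simp: h_def Plus_def image_Un image_image image_iff)
    have rel: "(\<Sum>j\<in>{..<n} <+> K. fscale (\<alpha> j) (h j)) = 0"
    proof
      fix r
      have sum: "(\<Sum>j\<in>{..<n} <+> K. fscale (\<alpha> j) (h j)) r =
          (\<Sum>c<n. x c * w c r) - (\<Sum>k\<in>K. V k * (if k \<in> T then y k r else e k r))"
        using finK by (auto simp: sum_fun_apply sum.Plus \<alpha>_def h_def simp flip: sum_negf intro!: sum.cong)
      show "(\<Sum>j\<in>{..<n} <+> K. fscale (\<alpha> j) (h j)) r = 0 r"
      proof (cases r)
        case (Inl p)
        have "(\<Sum>k\<in>K. V k * (if k \<in> T then y k r else e k r)) =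
            (\<Sum>k\<in>K. if k \<in> T then V k * u k (Inl p) else 0)"
          by (rule sum.cong) (auto simp: Inl y_def e_def)
        also have "\<dots> = (\<Sum>k\<in>T. V k * u k (Inl p))" using T finK by (simp add: sum.If_cases Int_absorb1)
        finally have K: "(\<Sum>k\<in>K. V k * (if k \<in> T then y k r else e k r)) = (\<Sum>k\<in>T. V k * u k (Inl p))" .
        show ?thesis
        proof (cases "p < n")
          case True
          have "(\<Sum>k\<in>T. V k * u k (Inl p)) = (\<Sum>c<n. x c * (\<Sum>k\<in>T. bf k p * cf k c))"
            unfolding V_def sum_distrib_right sum_distrib_left
            by (subst sum.swap) (simp add: u_def True mult_ac)
          then have "(\<Sum>c<n. x c * w c r) - (\<Sum>k\<in>T. V k * u k (Inl p)) = 0"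
            using x(3) True by (simp add: Inl w_def right_diff_distrib sum_subtractf)
          then show ?thesis unfolding sum K by simp
        qed (simp add: sum K, simp add: Inl w_def u_def)
      next
        case (Inr k)
        have "(\<Sum>k'\<in>K. V k' * (if k' \<in> T then y k' r else e k' r)) = (\<Sum>k'\<in>K. if k = k' then V k' else 0)"
          by (rule sum.cong) (auto simp: Inr y_def e_def u_def)
        also have "\<dots> = (if k \<in> K then V k else 0)" using finK by simp
        finally show ?thesis unfolding sum by (auto simp: Inr w_def V_def)
      qed
    qed
    have "fv.dim (h ` ({..<n} <+> K)) < card ({..<n} <+> K)"
      by (rule fv.dim_image_less_card[OF _ _ rel, of "Inl c0"]) (use x finK in \<open>auto simp: \<alpha>_def\<close>)
    then show "fv.dim (w ` {..<n} \<union> e ` (K - T) \<union> y ` T) < n + card K"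
      using finK by (simp add: h card_Plus)
  qed simp
  then obtain S where S: "S \<subseteq> K" "fv.dim (w ` {..<n} \<union> e ` S \<union> y ` S) < n + card S" by blast
  have finS: "finite S" using S finK finite_subset by blast
  \<comment> \<open>The coordinates \<open>Inr k\<close> with \<open>k \<in> S\<close> are those
    occupied by the vectors \<open>e k\<close>: splitting them off takes at least
    \<open>card S\<close> from the dimension and keeps the output entries of the triples outside
    \<open>S\<close>.\<close>
  define P where "P v r = (if r \<in> Inr ` S then 0 else v r)" for v :: "nat + nat \<times> nat \<times> nat \<Rightarrow> complex" and r
  have lin: "Vector_Spaces.linear fscale fscale P"
    by (rule linear_fscaleI) (auto simp: P_def fun_eq_iff)
  define Y where "Y = w ` {..<n} \<union> u ` S"
  have finY: "finite Y" using finS by (simp add: Y_def)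
  have "card S \<le> fv.dim (e ` S)"
  proof (rule ccontr)
    assume "\<not> card S \<le> fv.dim (e ` S)"
    then have "fv.dim (e ` S) < card S" by simp
    then obtain a k where k: "k \<in> S" "a k \<noteq> 0" "(\<Sum>j\<in>S. fscale (a j) (e j)) = 0"
      by (rule fv.dim_image_less_cardD[OF finS])
    have "(\<Sum>j\<in>S. if k = j then a j else 0) = (\<Sum>j\<in>S. a j * e j (Inr k))"
      by (rule sum.cong) (auto simp: e_def)
    also have "\<dots> = 0" using fun_cong[OF k(3), of "Inr k"] by (simp add: sum_fun_apply)
    finally show False using k finS by simp
  qed
  moreover have "fv.dim (e ` S) + fv.dim (P ` Y) \<le> fv.dim (e ` S \<union> Y)"
    by (rule fvp.dim_add_dim_image_le[OF lin _ finY]) (use finS in \<open>auto simp: P_def e_def fun_eq_iff\<close>)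
  moreover have "fv.dim (e ` S \<union> Y) \<le> fv.dim (w ` {..<n} \<union> e ` S \<union> y ` S)"
  proof (rule fv.dim_mono_finite)
    have "u k \<in> fv.span (w ` {..<n} \<union> e ` S \<union> y ` S)" if "k \<in> S" for k
    proof -
      have "u k = y k - e k" by (simp add: y_def)
      also have "\<dots> \<in> fv.span (w ` {..<n} \<union> e ` S \<union> y ` S)"
        using that by (intro fv.span_diff fv.span_base) auto
      finally show ?thesis .
    qed
    then show "e ` S \<union> Y \<subseteq> fv.span (w ` {..<n} \<union> e ` S \<union> y ` S)"
      unfolding Y_def using fv.span_superset[of "w ` {..<n} \<union> e ` S \<union> y ` S"] by blast
  qed (use finS in simp)
  ultimately have PY: "fv.dim (P ` Y) < n" using S(2) by linarith
  \<comment> \<open>For a channel in \<open>s\<close>, each input column is some \<open>u k\<close>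
    with \<open>k \<in> S\<close>. For the others, \<open>\<eta> i\<close> is an input without
    triples in \<open>S\<close>, so the coordinates \<open>(i, \<eta> i, b)\<close> survive
    \<open>P\<close> for all outputs \<open>b\<close>.\<close>
  define s where "s = {i. i < m \<and> (\<forall>a<dim_col (B i). \<exists>b<dim_row (C i). (i, a, b) \<in> S)}"
  obtain \<eta> where \<eta>: "\<And>i. i < m \<Longrightarrow> i \<notin> s \<Longrightarrow> \<eta> i < dim_col (B i) \<and> (\<forall>b<dim_row (C i). (i, \<eta> i, b) \<notin> S)"
    unfolding s_def by atomize_elim (rule choice, blast)
  define R :: "(nat + nat \<times> nat) set" where "R = range Inl \<union> {Inr (i, b) | i b. i < m \<and> i \<notin> s \<and> b < dim_row (C i)}"
  define \<rho> :: "nat + nat \<times> nat \<Rightarrow> nat + nat \<times> nat \<times> nat" where "\<rho> = case_sum Inl (\<lambda>(i, b). Inr (i, \<eta> i, b))"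
  have "fv.dim (sys_cols m A B C s lam) \<le> fv.dim (P ` Y)"
  proof (rule dim_le_row_pullback[where R = R and \<rho> = \<rho>])
    fix x' assume "x' \<in> sys_cols m A B C s lam"
    then consider c where "c < n" "x' = state_col m A C s lam c"
      | i a where "i \<in> s" "a < dim_col (B i)" "x' = input_col n B (i, a)"
      by (auto simp: sys_cols_def An)
    then show "\<exists>x\<in>P ` Y. \<forall>r. x' r = (if r \<in> R then x (\<rho> r) else 0)"
    proof cases
      case 1
      have "x' r = (if r \<in> R then P (w c) (\<rho> r) else 0)" for r
      proof (cases r)
        case (Inl p)
        then show ?thesis using 1 by (auto simp: R_def \<rho>_def P_def w_def state_col_def An)
      next
        case (Inr ib)
        then obtain i b where r: "r = Inr (i, b)" by (cases ib) auto
        show ?thesis using 1 \<eta>[of i]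
          by (auto simp: r R_def \<rho>_def P_def w_def state_col_def K_def cf_def)
      qed
      then show ?thesis using 1 by (intro bexI[of _ "P (w c)"]) (auto simp: Y_def)
    next
      case 2
      \<comment> \<open>Which output \<open>b\<close> occurs is irrelevant:
        \<open>u (i, a, b)\<close> represents input column \<open>a\<close> whatever
        \<open>b\<close> is.\<close>
      then obtain b where b: "b < dim_row (C i)" "(i, a, b) \<in> S" by (auto simp: s_def)
      have "x' r = (if r \<in> R then P (u (i, a, b)) (\<rho> r) else 0)" for r
      proof (cases r)
        case (Inl p)
        then show ?thesis using 2 by (auto simp: R_def \<rho>_def P_def u_def input_col_def bf_def)
      next
        case (Inr ib)
        then obtain i b where r: "r = Inr (i, b)" by (cases ib) auto
        show ?thesis using 2 by (auto simp: r R_def \<rho>_def P_def u_def input_col_def)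
      qed
      then show ?thesis using b by (intro bexI[of _ "P (u (i, a, b))"]) (auto simp: Y_def)
    qed
  qed (use finY in simp)
  moreover have "s \<subseteq> {0..<m}" by (auto simp: s_def)
  ultimately show ?thesis using PY that by (meson le_less_trans)
qed

text \<open>This is the algebraic characterization of fixed modes due to Anderson and Clements.\<close>

theorem fixed_eigenvalue_iff:
  assumes "A \<in> carrier_mat n n" "\<forall>i<m. dim_row (B i) = n" "\<forall>i<m. dim_col (C i) = n"
  shows "fixed_eigenvalue m A B C lam \<longleftrightarrow> (\<exists>s\<subseteq>{0..<m}. mrank (test_mat m A B C s lam) < n)"
  using fixed_eigenvalue_if_rank_less[OF assms] rank_less_if_fixed_eigenvalue[OF assms]
    mrank_test_mat[OF assms] by metis

subsection \<open>Entries of the extended system\<close>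

lemma blockdiag_list_simps [simp]:
  "blockdiag_list [] = 0\<^sub>m 0 0" "blockdiag_list (M # Ms) = blockdiag M (blockdiag_list Ms)"
  by (simp_all add: blockdiag_list_def)

lemma dim_blockdiag [simp]:
  "dim_row (blockdiag M1 M2) = dim_row M1 + dim_row M2"
  "dim_col (blockdiag M1 M2) = dim_col M1 + dim_col M2"
  by (simp_all add: blockdiag_def)

lemma dim_blockdiag_list:
  assumes "\<forall>M\<in>set Ms. dim_col M = dim_row M"
  shows "dim_row (blockdiag_list Ms) = sum_list (map dim_row Ms)"
    and "dim_col (blockdiag_list Ms) = sum_list (map dim_row Ms)"
  using assms by (induction Ms) auto

lemma blockdiag_list_index:
  assumes "\<forall>M\<in>set Ms. dim_col M = dim_row M" "k < length Ms" "r < dim_row (Ms ! k)"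
    and "q < sum_list (map dim_row Ms)" "off = sum_list (map dim_row (take k Ms))"
  shows "blockdiag_list Ms $$ (off + r, q) =
    (if off \<le> q \<and> q < off + dim_row (Ms ! k) then (Ms ! k) $$ (r, q - off) else 0)"
  using assms
proof (induction Ms arbitrary: k q off)
  case (Cons M Ms)
  have dims: "dim_col M = dim_row M" "dim_row (blockdiag_list Ms) = sum_list (map dim_row Ms)"
    "dim_col (blockdiag_list Ms) = sum_list (map dim_row Ms)"
    using Cons.prems(1) dim_blockdiag_list[of Ms] by auto
  show ?case
  proof (cases k)
    case 0
    then show ?thesis using Cons.prems dims by (auto simp: blockdiag_def)
  next
    case (Suc k')
    define off' where "off' = sum_list (map dim_row (take k' Ms))"
    have off: "off = dim_row M + off'" using Cons.prems Suc by (simp add: off'_def)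
    have k': "k' < length Ms" "r < dim_row (Ms ! k')" using Cons.prems Suc by auto
    have "sum_list (map dim_row Ms) =
        off' + dim_row (Ms ! k') + sum_list (map dim_row (drop (Suc k') Ms))"
      using id_take_nth_drop[OF k'(1)] unfolding off'_def
      by (metis map_append map_eq_Cons_conv sum_list.Cons sum_list.append add.assoc)
    then have r: "off' + r < sum_list (map dim_row Ms)" using k' by simp
    show ?thesis
    proof (cases "q < dim_row M")
      case True
      then show ?thesis using r dims by (simp add: blockdiag_def off)
    next
      case False
      then have q: "q - dim_row M < sum_list (map dim_row Ms)" using Cons.prems(4) by auto
      have "blockdiag_list (M # Ms) $$ (off + r, q) = blockdiag_list Ms $$ (off' + r, q - dim_row M)"
        using r q False dims by (simp add: blockdiag_def off)
      also have "\<dots> = (if off' \<le> q - dim_row M \<and> q - dim_row M < off' + dim_row (Ms ! k')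
          then (Ms ! k') $$ (r, q - dim_row M - off') else 0)"
        by (rule Cons.IH[OF _ k' q off'_def]) (use Cons.prems(1) in auto)
      finally show ?thesis using False Suc by (auto simp: off)
    qed
  qed
qed auto

section \<open>Addresses in the delay lines\<close>

lemma zoff_Suc: "zoff nz dd (Suc k) = zoff nz dd k + (dd k + 1) * nz k"
  by (simp add: zoff_def)

lemma zoff_mono: "k \<le> k' \<Longrightarrow> zoff nz dd k \<le> zoff nz dd k'"
  unfolding zoff_def by (rule sum_mono2) auto

lemma zoff_block_less:
  assumes "k < m" "r < (dd k + 1) * nz k"
  shows "zoff nz dd k + r < zoff nz dd m"
  using zoff_mono[of "Suc k" m nz dd] assms by (simp add: zoff_Suc)

lemma zoff_block_unique:
  assumes "zoff nz dd k \<le> q" "q < zoff nz dd (Suc k)" "zoff nz dd k' \<le> q" "q < zoff nz dd (Suc k')"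
  shows "k = k'"
  using zoff_mono[of "Suc k" k' nz dd] zoff_mono[of "Suc k'" k nz dd] assms by (cases k k' rule: linorder_cases) auto

lemma zoff_blockE:
  assumes "q < zoff nz dd m"
  obtains k where "k < m" "zoff nz dd k \<le> q" "q < zoff nz dd (Suc k)"
proof -
  have "\<exists>k<m. zoff nz dd k \<le> q \<and> q < zoff nz dd (Suc k)"
    using assms
  proof (induction m)
    case (Suc m)
    then show ?case by (cases "q < zoff nz dd m") (auto intro: less_SucI)
  qed (simp add: zoff_def)
  then show ?thesis using that by blast
qed

lemma delay_index_less:
  assumes "\<delta> \<le> dd k" "e < nz k"
  shows "\<delta> * nz k + e < (dd k + 1) * (nz k :: nat)"
proof -
  have "\<delta> * nz k + e < \<delta> * nz k + nz k" using assms by simp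
  also have "\<dots> = (\<delta> + 1) * nz k" by simp
  also have "\<dots> \<le> (dd k + 1) * nz k" using assms by (intro mult_right_mono) auto
  finally show ?thesis .
qed

lemma delay_index_block:
  assumes "\<delta> \<le> dd k" "e < nz k"
  shows "zoff nz dd k \<le> zoff nz dd k + \<delta> * nz k + e" "zoff nz dd k + \<delta> * nz k + e < zoff nz dd (Suc k)"
  using delay_index_less[of \<delta> dd k e nz] assms unfolding zoff_Suc by linarith+

lemma delay_index_Nz:
  assumes "k < m" "\<delta> \<le> dd k" "e < nz k"
  shows "zoff nz dd k + \<delta> * nz k + e < Nz m nz dd"
  using zoff_block_less[of k m "\<delta> * nz k + e" dd nz] delay_index_less[of \<delta> dd k e nz] assms
  by (simp add: Nz_def add.assoc)

text \<open>An address splits into block, delay and component; division by \<open>nz k\<close> is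
  sound because a block that contains \<open>q\<close> is not empty.\<close>

lemma delay_indexE:
  assumes "q < Nz m nz dd"
  obtains k \<delta> e where "k < m" "\<delta> \<le> dd k" "e < nz k" "q = zoff nz dd k + \<delta> * nz k + e"
proof -
  obtain k where k: "k < m" "zoff nz dd k \<le> q" "q < zoff nz dd (Suc k)"
    using zoff_blockE assms unfolding Nz_def by blast
  define r where "r = q - zoff nz dd k"
  have r: "r < (dd k + 1) * nz k" using k by (simp add: r_def zoff_Suc)
  then have pos: "nz k > 0" by (cases "nz k") auto
  have "r div nz k < dd k + 1" using r by (simp add: less_mult_imp_div_less)
  moreover have "q = zoff nz dd k + (r div nz k) * nz k + r mod nz k" using k by (simp add: r_def)
  ultimately show ?thesis using that[of k "r div nz k" "r mod nz k"] k pos by simp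
qed

lemma A_ext_carrier: "A \<in> carrier_mat n n \<Longrightarrow> A_ext m A nz dd \<in> carrier_mat (n + Nz m nz dd) (n + Nz m nz dd)"
proof -
  have "sum_list (map dim_row (map (\<lambda>k. shift_mat (nz k) (dd k)) [0..<m])) = Nz m nz dd"
    by (simp add: shift_mat_def o_def interv_sum_list_conv_sum_set_nat Nz_def zoff_def lessThan_atLeast0)
  then show "A \<in> carrier_mat n n \<Longrightarrow> ?thesis"
    using dim_blockdiag_list[of "map (\<lambda>k. shift_mat (nz k) (dd k)) [0..<m]"]
    by (auto simp: A_ext_def shift_mat_def)
qed

text \<open>In the last clause the entry at \<open>p = q + nz k\<close> moves a signal from one
  delay to the next. The range condition on \<open>q\<close> keeps the undelayed rows of block
  \<open>k\<close> zero; they could otherwise pick up an entry from a preceding block.\<close>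

lemma A_ext_index:
  assumes A: "A \<in> carrier_mat n n"
  shows "p < n \<Longrightarrow> q < n \<Longrightarrow> A_ext m A nz dd $$ (p, q) = A $$ (p, q)"
    and "p < n \<Longrightarrow> q < Nz m nz dd \<Longrightarrow> A_ext m A nz dd $$ (p, n + q) = 0"
    and "p < Nz m nz dd \<Longrightarrow> q < n \<Longrightarrow> A_ext m A nz dd $$ (n + p, q) = 0"
    and "k < m \<Longrightarrow> zoff nz dd k \<le> p \<Longrightarrow> p < zoff nz dd (Suc k) \<Longrightarrow> q < Nz m nz dd \<Longrightarrow>
      A_ext m A nz dd $$ (n + p, n + q) =
      (if zoff nz dd k \<le> q \<and> q < zoff nz dd (Suc k) \<and> p = q + nz k then 1 else 0)"
proof -
  define Ms where "Ms = map (\<lambda>k. shift_mat (nz k) (dd k)) [0..<m]"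
  have sq: "\<forall>M\<in>set Ms. dim_col M = dim_row M" by (auto simp: Ms_def shift_mat_def)
  have off: "sum_list (map dim_row (take k Ms)) = zoff nz dd k" if "k \<le> m" for k
    using that by (simp add: Ms_def take_map shift_mat_def o_def interv_sum_list_conv_sum_set_nat
        zoff_def lessThan_atLeast0 take_upt)
  have tot: "sum_list (map dim_row Ms) = Nz m nz dd"
    using off[of m] by (simp add: Nz_def Ms_def)
  have An: "dim_row A = n" "dim_col A = n" using A by auto
  note dims = dim_blockdiag_list[OF sq, unfolded tot]
  note defs = A_ext_def Ms_def[symmetric] blockdiag_def[of A]
  show "p < n \<Longrightarrow> q < n \<Longrightarrow> A_ext m A nz dd $$ (p, q) = A $$ (p, q)"
    "p < n \<Longrightarrow> q < Nz m nz dd \<Longrightarrow> A_ext m A nz dd $$ (p, n + q) = 0"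
    "p < Nz m nz dd \<Longrightarrow> q < n \<Longrightarrow> A_ext m A nz dd $$ (n + p, q) = 0"
    unfolding defs using An dims by simp_all
  assume k: "k < m" "zoff nz dd k \<le> p" "p < zoff nz dd (Suc k)" and q: "q < Nz m nz dd"
  define r where "r = p - zoff nz dd k"
  have p: "p = zoff nz dd k + r" "r < (dd k + 1) * nz k" using k by (simp_all add: r_def zoff_Suc)
  have Mk: "Ms ! k = shift_mat (nz k) (dd k)" "k < length Ms" using k by (simp_all add: Ms_def)
  have pN: "p < Nz m nz dd" using zoff_block_less[of k m r dd nz] k p by (simp add: Nz_def)
  have "A_ext m A nz dd $$ (n + p, n + q) = blockdiag_list Ms $$ (zoff nz dd k + r, q)"
    unfolding defs p(1)[symmetric] using An dims pN q by simp
  also have "\<dots> = (if zoff nz dd k \<le> q \<and> q < zoff nz dd k + dim_row (Ms ! k)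
      then (Ms ! k) $$ (r, q - zoff nz dd k) else 0)"
    by (rule blockdiag_list_index[OF sq Mk(2)]) (use k q p off Mk in \<open>simp_all add: tot shift_mat_def\<close>)
  also have "\<dots> = (if zoff nz dd k \<le> q \<and> q < zoff nz dd (Suc k) \<and> p = q + nz k then 1 else 0)"
    using p by (auto simp: Mk shift_mat_def zoff_Suc)
  finally show "A_ext m A nz dd $$ (n + p, n + q) =
      (if zoff nz dd k \<le> q \<and> q < zoff nz dd (Suc k) \<and> p = q + nz k then 1 else 0)" .
qed

lemma B_ext_dims: "dim_row (B_ext m B nz dd i) = dim_row (B i) + Nz m nz dd"
    "dim_col (B_ext m B nz dd i) = dim_col (B i) + nz i"
  by (simp_all add: B_ext_def Hmat_def)

lemma B_ext_index:
  assumes "dim_row (B i) = n" "p < n + Nz m nz dd"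
  shows "a < dim_col (B i) \<Longrightarrow> B_ext m B nz dd i $$ (p, a) = (if p < n then B i $$ (p, a) else 0)"
    and "e < nz i \<Longrightarrow> B_ext m B nz dd i $$ (p, dim_col (B i) + e) = (if p = n + zoff nz dd i + e then 1 else 0)"
  using assms by (auto simp: B_ext_def blockdiag_def Hmat_def)

context
  fixes n m :: nat and C :: "nat \<Rightarrow> real mat" and N :: "nat \<Rightarrow> nat set" and d :: "nat \<Rightarrow> nat \<Rightarrow> nat"
    and nz dd :: "nat \<Rightarrow> nat" and i :: nat
  assumes Cn: "dim_col (C i) = n" and finN: "finite (N i)"
begin

definition meas_rows :: "real mat" where
  "meas_rows = vcat_list (n + Nz m nz dd)
     (map (\<lambda>j. hcat (0\<^sub>m (nz j) n) (transpose_mat (Hmat m nz dd j (d j i)))) (sorted_list_of_set (N i)))"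

lemma C_ext_dims: "dim_row (C_ext n m C N d nz dd i) = dim_row (C i) + dim_row meas_rows"
    "dim_col (C_ext n m C N d nz dd i) = n + Nz m nz dd"
  using Cn by (simp_all add: C_ext_def meas_rows_def)

lemma C_ext_index:
  assumes "b < dim_row (C i)" "c < n + Nz m nz dd"
  shows "C_ext n m C N d nz dd i $$ (b, c) = (if c < n then C i $$ (b, c) else 0)"
  using assms Cn by (simp add: C_ext_def vcat_def hcat_def)

lemma C_ext_meas_index:
  assumes "b < dim_row meas_rows" "c < n + Nz m nz dd"
  shows "C_ext n m C N d nz dd i $$ (dim_row (C i) + b, c) = meas_rows $$ (b, c)"
  using assms Cn by (simp add: C_ext_def vcat_def meas_rows_def[symmetric])

lemma meas_block_index:
  assumes "e < nz j" "c < n + Nz m nz dd"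
  shows "hcat (0\<^sub>m (nz j) n) (transpose_mat (Hmat m nz dd j (d j i))) $$ (e, c) =
    (if c = n + zoff nz dd j + d j i * nz j + e then 1 else 0)"
  using assms by (auto simp: hcat_def Hmat_def)

lemma meas_blocks:
  "\<forall>M\<in>set (map (\<lambda>j. hcat (0\<^sub>m (nz j) n) (transpose_mat (Hmat m nz dd j (d j i)))) (sorted_list_of_set (N i))).
     dim_col M = n + Nz m nz dd"
  by (auto simp: Hmat_def)

text \<open>Below the rows of \<open>C i\<close> every row is a unit row pointing at one component
  of one received signal, so the address of its 1 is all that has to be known. The companion lemma
  finds a row for each such address.\<close>

lemma C_ext_rowE:
  assumes "dim_row (C i) \<le> b" "b < dim_row (C_ext n m C N d nz dd i)"
  obtains j e where "j \<in> N i" "e < nz j" "\<forall>c<n + Nz m nz dd. C_ext n m C N d nz dd i $$ (b, c) =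
    (if c = n + zoff nz dd j + d j i * nz j + e then 1 else 0)"
proof -
  define b' where "b' = b - dim_row (C i)"
  have b: "b = dim_row (C i) + b'" "b' < dim_row meas_rows"
    using assms by (simp_all add: b'_def C_ext_dims)
  obtain M e where M: "M \<in> set (map (\<lambda>j. hcat (0\<^sub>m (nz j) n) (transpose_mat (Hmat m nz dd j (d j i))))
      (sorted_list_of_set (N i)))" "e < dim_row M" "\<forall>c<n + Nz m nz dd. meas_rows $$ (b', c) = M $$ (e, c)"
    by (rule vcat_list_rowE[OF meas_blocks b(2)[unfolded meas_rows_def], folded meas_rows_def])
  then obtain j where "j \<in> N i" "M = hcat (0\<^sub>m (nz j) n) (transpose_mat (Hmat m nz dd j (d j i)))"
    using finN by auto
  then show ?thesis using that[of j e] M meas_block_index[of e j] C_ext_meas_index[OF b(2)] by (simp add: b(1))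
qed

lemma C_ext_row_ex:
  assumes "j \<in> N i" "e < nz j"
  obtains b where "dim_row (C i) \<le> b" "b < dim_row (C_ext n m C N d nz dd i)"
    "\<forall>c<n + Nz m nz dd. C_ext n m C N d nz dd i $$ (b, c) =
    (if c = n + zoff nz dd j + d j i * nz j + e then 1 else 0)"
proof -
  have "\<exists>q<dim_row meas_rows. \<forall>c<n + Nz m nz dd. meas_rows $$ (q, c) =
      hcat (0\<^sub>m (nz j) n) (transpose_mat (Hmat m nz dd j (d j i))) $$ (e, c)"
    unfolding meas_rows_def by (rule vcat_list_row_ex[OF meas_blocks]) (use assms finN in auto)
  then obtain q where q: "q < dim_row meas_rows" "\<forall>c<n + Nz m nz dd. meas_rows $$ (q, c) =
    (if c = n + zoff nz dd j + d j i * nz j + e then 1 else 0)"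
    using meas_block_index[OF assms(2)] by auto
  then show ?thesis
    using that[of "dim_row (C i) + q"] C_ext_meas_index[OF q(1)] by (simp add: C_ext_dims)
qed

end

subsection \<open>Rank of the extended test matrix\<close>

context
  fixes n m :: nat and A :: "real mat" and B C :: "nat \<Rightarrow> real mat" and N :: "nat \<Rightarrow> nat set"
    and d :: "nat \<Rightarrow> nat \<Rightarrow> nat" and nz dd :: "nat \<Rightarrow> nat" and lam :: complex and s :: "nat set"
  assumes A: "A \<in> carrier_mat n n" and B: "\<forall>i<m. dim_row (B i) = n" and C: "\<forall>i<m. dim_col (C i) = n"
    and N: "\<forall>i<m. N i \<subseteq> {0..<m}" and delay: "\<forall>i<m. \<forall>j\<in>N i. d j i \<le> dd j"
    and s: "s \<subseteq> {0..<m}"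
begin

abbreviation (input) "Ae \<equiv> A_ext m A nz dd"
abbreviation (input) "Be \<equiv> B_ext m B nz dd"
abbreviation (input) "Ce \<equiv> C_ext n m C N d nz dd"
abbreviation (input) "nN \<equiv> n + Nz m nz dd"
abbreviation (input) "enc k \<delta> e \<equiv> zoff nz dd k + \<delta> * nz k + e"

definition zcol :: "nat \<Rightarrow> nat + nat \<times> nat \<Rightarrow> complex" where
  "zcol q = state_col m Ae Ce s lam (n + q)"

text \<open>The input \<open>v_i\<close> enters its delay line in the slot of delay 0, hence the
  address without a delay term.\<close>

definition vcol :: "nat \<times> nat \<Rightarrow> nat + nat \<times> nat \<Rightarrow> complex" where
  "vcol ie r = (if r = Inl (n + zoff nz dd (fst ie) + snd ie) then 1 else 0)"

definition ctrl_cols :: "(nat + nat \<times> nat \<Rightarrow> complex) set" where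
  "ctrl_cols = zcol ` {..<Nz m nz dd} \<union> vcol ` (SIGMA i:s. {..<nz i})"

lemma finite_channels: "finite s"
  using s finite_subset by blast

lemma finite_ctrl_cols: "finite ctrl_cols"
  using finite_channels by (simp add: ctrl_cols_def)

lemma state_dims: "dim_row A = n" "dim_row Ae = nN"
  using A A_ext_carrier[OF A] by auto

lemma finite_neighbors: "i < m \<Longrightarrow> finite (N i)"
  using N finite_subset by blast

lemma dim_col_output: "i < m \<Longrightarrow> dim_col (C i) = n"
  using C by blast

lemma Ce_dims: "i < m \<Longrightarrow> dim_row (Ce i) = dim_row (C i) + dim_row (meas_rows n m N d nz dd i)"
  using C_ext_dims(1)[of C i n N m d nz dd] dim_col_output finite_neighbors by blast

lemma Ce_index:
  "i < m \<Longrightarrow> b < dim_row (C i) \<Longrightarrow> c < nN \<Longrightarrow> Ce i $$ (b, c) = (if c < n then C i $$ (b, c) else 0)"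
  using C_ext_index[of C i n N b c m nz dd d] dim_col_output finite_neighbors by blast

lemma Ce_rowE:
  assumes "i < m" "dim_row (C i) \<le> b" "b < dim_row (Ce i)"
  obtains j e where "j \<in> N i" "e < nz j"
    "\<forall>c<nN. Ce i $$ (b, c) = (if c = n + zoff nz dd j + d j i * nz j + e then 1 else 0)"
  using C_ext_rowE[of C i n N b m d nz dd] dim_col_output finite_neighbors assms by blast

lemma Ce_row_ex:
  assumes "i < m" "j \<in> N i" "e < nz j"
  obtains b where "dim_row (C i) \<le> b" "b < dim_row (Ce i)"
    "\<forall>c<nN. Ce i $$ (b, c) = (if c = n + zoff nz dd j + d j i * nz j + e then 1 else 0)"
  using C_ext_row_ex[of C i n N j e nz m d dd] dim_col_output finite_neighbors assms by blast

text \<open>The blocks of \<open>A_ext\<close> below \<open>A\<close> vanish and the measurement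
  rows see only controller coordinates, so nothing is added to a plant column.\<close>

lemma state_col_ext:
  assumes c: "c < n"
  shows "state_col m Ae Ce s lam c = state_col m A C s lam c"
proof
  fix r
  show "state_col m Ae Ce s lam c r = state_col m A C s lam c r"
  proof (cases r)
    case (Inl p)
    consider "p < n" | p' where "p = n + p'" "p' < Nz m nz dd" | "p \<ge> nN"
      by (metis add_less_cancel_left le_add_diff_inverse not_le)
    then show ?thesis
      using c A_ext_index(1,3)[OF A, where q = c and nz = nz and dd = dd and m = m]
      by cases (auto simp: Inl state_col_def state_dims)
  next
    case (Inr ib)
    then obtain i b where r: "r = Inr (i, b)" by (cases ib) auto
    show ?thesis
    proof (cases "i < m \<and> i \<notin> s \<and> b < dim_row (Ce i)")
      case True
      then have i: "i < m" "b < dim_row (Ce i)" by auto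
      show ?thesis
      proof (cases "b < dim_row (C i)")
        case True
        then show ?thesis using c Ce_index[OF i(1) True, of c]
          by (auto simp: r state_col_def Ce_dims)
      next
        case False
        then have "dim_row (C i) \<le> b" by simp
        from Ce_rowE[OF i(1) this i(2)] obtain j e where
          "\<forall>c<nN. Ce i $$ (b, c) = (if c = n + zoff nz dd j + d j i * nz j + e then 1 else 0)" by metis
        then show ?thesis using c False by (auto simp: r state_col_def)
      qed
    next
      case False
      then show ?thesis by (auto simp: r state_col_def Ce_dims)
    qed
  qed
qed

lemma input_col_ext:
  assumes "i \<in> s" "a < dim_col (B i)"
  shows "input_col nN Be (i, a) = input_col n B (i, a)"
proof -
  have "dim_row (B i) = n" using assms s B by auto
  then show ?thesis using assms B_ext_index(1)[of B i n _ m nz dd a]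
    by (auto simp: input_col_def fun_eq_iff split: sum.split)
qed

lemma input_col_ext_ctrl:
  assumes "i \<in> s" "e < nz i"
  shows "input_col nN Be (i, dim_col (B i) + e) = vcol (i, e)"
proof -
  have i: "dim_row (B i) = n" "i < m" using assms s B by auto
  have "zoff nz dd i + e < Nz m nz dd" using delay_index_Nz[of i m 0 dd e nz] i assms by simp
  then show ?thesis using assms i B_ext_index(2)[of B i n _ m nz dd e]
    by (auto simp: input_col_def vcol_def fun_eq_iff split: sum.split)
qed

text \<open>Row labels agree in both systems because \<open>C i\<close> sits on top of
  \<open>C_ext\<close> and output \<open>b\<close> keeps its number. The extension therefore only
  adjoins columns to the set.\<close>

lemma sys_cols_ext: "sys_cols m Ae Be Ce s lam = sys_cols m A B C s lam \<union> ctrl_cols"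
proof -
  have "state_col m Ae Ce s lam ` {..<nN} = state_col m A C s lam ` {..<n} \<union> zcol ` {..<Nz m nz dd}"
  proof -
    have "{..<nN} = {..<n} \<union> (\<lambda>q. n + q) ` {..<Nz m nz dd}"
      using lessThan_atLeast0 by (auto simp: image_iff)
    then show ?thesis using state_col_ext by (auto simp: image_Un image_image zcol_def)
  qed
  moreover have "input_col nN Be ` (SIGMA i:s. {..<dim_col (Be i)}) =
      input_col n B ` (SIGMA i:s. {..<dim_col (B i)}) \<union> vcol ` (SIGMA i:s. {..<nz i})"
  proof -
    have "(SIGMA i:s. {..<dim_col (Be i)}) = (SIGMA i:s. {..<dim_col (B i)}) \<union>
        (\<lambda>(i, e). (i, dim_col (B i) + e)) ` (SIGMA i:s. {..<nz i})"
    proof (intro equalityI subsetI)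
      fix x assume "x \<in> (SIGMA i:s. {..<dim_col (Be i)})"
      then obtain i a where x: "x = (i, a)" "i \<in> s" "a < dim_col (B i) + nz i" by (auto simp: B_ext_dims)
      show "x \<in> (SIGMA i:s. {..<dim_col (B i)}) \<union> (\<lambda>(i, e). (i, dim_col (B i) + e)) ` (SIGMA i:s. {..<nz i})"
      proof (cases "a < dim_col (B i)")
        case False
        then show ?thesis using x by (intro UnI2 image_eqI[of _ _ "(i, a - dim_col (B i))"]) auto
      qed (use x in auto)
    qed (auto simp: B_ext_dims)
    moreover have "input_col nN Be ` (SIGMA i:s. {..<dim_col (B i)}) = input_col n B ` (SIGMA i:s. {..<dim_col (B i)})"
      by (rule image_cong) (auto simp: input_col_ext)
    moreover have "(\<lambda>ie. input_col nN Be (case ie of (i, e) \<Rightarrow> (i, dim_col (B i) + e))) ` (SIGMA i:s. {..<nz i}) =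
        vcol ` (SIGMA i:s. {..<nz i})"
      by (rule image_cong) (auto simp: input_col_ext_ctrl)
    ultimately show ?thesis by (simp add: image_Un image_image)
  qed
  ultimately show ?thesis by (auto simp: sys_cols_def ctrl_cols_def state_dims)
qed

lemma zcol_state: "p < n \<Longrightarrow> q < Nz m nz dd \<Longrightarrow> zcol q (Inl p) = 0"
  using A_ext_index(2)[OF A, of p q m nz dd] by (simp add: zcol_def state_col_def state_dims)

lemma zcol_out: "nN \<le> p \<Longrightarrow> zcol q (Inl p) = 0"
  by (simp add: zcol_def state_col_def state_dims)

lemma zcol_block:
  assumes "k < m" "zoff nz dd k \<le> p" "p < zoff nz dd (Suc k)" "q < Nz m nz dd"
  shows "zcol q (Inl (n + p)) = (if p = q then lam else 0) -
    (if zoff nz dd k \<le> q \<and> q < zoff nz dd (Suc k) \<and> p = q + nz k then 1 else 0)"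
proof -
  have "p < Nz m nz dd" using assms zoff_mono[of "Suc k" m nz dd] by (simp add: Nz_def)
  then show ?thesis using A_ext_index(4)[OF A assms] by (simp add: zcol_def state_col_def state_dims)
qed

lemma zcol_output:
  assumes "q < Nz m nz dd" "b < dim_row (C i)"
  shows "zcol q (Inr (i, b)) = 0"
proof (cases "i < m")
  case True
  then show ?thesis using Ce_index[OF True assms(2), of "n + q"] assms
    by (simp add: zcol_def state_col_def)
qed (simp add: zcol_def state_col_def)

lemma zcol_meas_nonzero:
  assumes q: "q < Nz m nz dd" and nonzero: "zcol q (Inr (i, b)) \<noteq> 0"
  obtains j e where "i < m" "i \<notin> s" "j \<in> N i" "e < nz j" "q = enc j (d j i) e"
proof -
  have i: "i < m" "i \<notin> s" "b < dim_row (Ce i)" using nonzero by (auto simp: zcol_def state_col_def split: if_splits)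
  have "dim_row (C i) \<le> b" using zcol_output[OF q, of b i] nonzero by fastforce
  from Ce_rowE[OF i(1) this i(3)] obtain j e where
    je: "j \<in> N i" "e < nz j" "\<forall>c<nN. Ce i $$ (b, c) = (if c = n + zoff nz dd j + d j i * nz j + e then 1 else 0)" .
  then have "q = enc j (d j i) e" using nonzero q i by (auto simp: zcol_def state_col_def split: if_splits)
  then show ?thesis using that i je by blast
qed

text \<open>If nobody outside \<open>s\<close> hears an agent in \<open>s\<close>, the columns of a
  block \<open>k \<in> s\<close> are supported on that block alone. The unit vectors of the blocks
  in \<open>s\<close> and the given columns of the other blocks, one vector per controller
  coordinate, thus span all adjoined columns, inputs included.\<close>

lemma dim_sys_cols_ext_le:
  assumes sep: "N_set N ({0..<m} - s) \<inter> s = {}"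
  shows "fv.dim (sys_cols m Ae Be Ce s lam) \<le> fv.dim (sys_cols m A B C s lam) + Nz m nz dd"
proof -
  define unit :: "nat \<Rightarrow> nat + nat \<times> nat \<Rightarrow> complex" where
    "unit q r = (if r = Inl (n + q) then 1 else 0)" for q r
  define g where "g q = (if \<exists>k\<in>s. zoff nz dd k \<le> q \<and> q < zoff nz dd (Suc k) then unit q else zcol q)" for q
  have unit: "unit p \<in> fv.span (g ` {..<Nz m nz dd})"
    if "k \<in> s" "zoff nz dd k \<le> p" "p < zoff nz dd (Suc k)" for k p
  proof -
    have "k < m" using that s by auto
    then have "p < Nz m nz dd" using that(3) zoff_mono[of "Suc k" m nz dd] by (simp add: Nz_def)
    moreover have "g p = unit p" using that by (auto simp: g_def)
    ultimately show ?thesis by (metis fv.span_base image_eqI lessThan_iff)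
  qed
  have "ctrl_cols \<subseteq> fv.span (g ` {..<Nz m nz dd})"
  proof
    fix v assume "v \<in> ctrl_cols"
    then consider q where "q < Nz m nz dd" "v = zcol q" | i e where "i \<in> s" "e < nz i" "v = vcol (i, e)"
      by (auto simp: ctrl_cols_def)
    then show "v \<in> fv.span (g ` {..<Nz m nz dd})"
    proof cases
      case 1
      obtain k where k: "k < m" "zoff nz dd k \<le> q" "q < zoff nz dd (Suc k)"
        using zoff_blockE 1(1) unfolding Nz_def by blast
      show ?thesis
      proof (cases "k \<in> s")
        case True
        define P where "P = {zoff nz dd k..<zoff nz dd (Suc k)}"
        \<comment> \<open>A column can leave its block only through a measurement row of an agent
          outside \<open>s\<close>, which \<open>sep\<close> excludes.\<close>
        have supp: "zcol q r = 0" if r: "r \<notin> (\<lambda>p. Inl (n + p)) ` P" for r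
        proof (cases r)
          case (Inl p)
          consider "p < n" | p' where "p = n + p'" "p' < Nz m nz dd" | "p \<ge> nN"
            by (metis add_less_cancel_left le_add_diff_inverse not_le)
          then show ?thesis
          proof cases
            case 2
            obtain k' where k': "k' < m" "zoff nz dd k' \<le> p'" "p' < zoff nz dd (Suc k')"
              using zoff_blockE 2(2) unfolding Nz_def by blast
            have "p' \<notin> P" using r 2 Inl by blast
            then have "k' \<noteq> k" using k' by (auto simp: P_def)
            then have "\<not> (zoff nz dd k' \<le> q \<and> q < zoff nz dd (Suc k'))" using k zoff_block_unique by blast
            then show ?thesis using zcol_block[OF k' 1(1)] k' by (auto simp: Inl 2)
          qed (use 1 Inl zcol_state zcol_out in auto)
        next
          case (Inr ib)
          then obtain i b where r: "r = Inr (i, b)" by (cases ib) auto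
          show ?thesis
          proof (rule ccontr)
            assume "zcol q r \<noteq> 0"
            from zcol_meas_nonzero[OF 1(1) this[unfolded r]] obtain j e where
              je: "i < m" "i \<notin> s" "j \<in> N i" "e < nz j" "q = enc j (d j i) e" .
            have "d j i \<le> dd j" using je delay by blast
            from delay_index_block[of "d j i" dd j e nz, OF this je(4)] k have "j = k"
              using zoff_block_unique je(5) by metis
            then have "k \<in> N_set N ({0..<m} - s)" using je by (auto simp: N_set_def)
            then show False using sep True by blast
          qed
        qed
        have "zcol q = (\<Sum>p\<in>P. fscale (zcol q (Inl (n + p))) (unit p))"
        proof
          fix r
          have "(\<Sum>p\<in>P. fscale (zcol q (Inl (n + p))) (unit p)) r =
              (\<Sum>p\<in>P. if r = Inl (n + p) then zcol q r else 0)"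
            unfolding sum_fun_apply by (rule sum.cong) (auto simp: unit_def)
          also have "\<dots> = zcol q r"
          proof (cases "r \<in> (\<lambda>p. Inl (n + p)) ` P")
            case True
            then obtain p where "p \<in> P" "r = Inl (n + p)" by blast
            then show ?thesis by (simp add: P_def)
          next
            case False
            then show ?thesis using supp[OF False] by (auto intro!: sum.neutral)
          qed
          finally show "zcol q r = (\<Sum>p\<in>P. fscale (zcol q (Inl (n + p))) (unit p)) r" by simp
        qed
        also have "\<dots> \<in> fv.span (g ` {..<Nz m nz dd})"
          by (intro fv.span_sum fv.span_scale unit[OF True]) (auto simp: P_def)
        finally show ?thesis by (simp add: 1)
      next
        case False
        then have "g q = zcol q" using k zoff_block_unique by (metis g_def)
        then show ?thesis using 1 by (metis fv.span_base image_eqI lessThan_iff)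
      qed
    next
      case 2
      have "v = unit (zoff nz dd i + e)" by (auto simp: 2 vcol_def unit_def fun_eq_iff add.assoc)
      moreover have "zoff nz dd i + e < zoff nz dd (Suc i)"
        using delay_index_block(2)[of 0 dd i e nz] 2 by simp
      ultimately show ?thesis using unit[OF 2(1)] by simp
    qed
  qed
  then have "fv.dim ctrl_cols \<le> card (g ` {..<Nz m nz dd})" by (rule fv.dim_le_card) simp
  also have "\<dots> \<le> Nz m nz dd" using card_image_le[of "{..<Nz m nz dd}" g] by simp
  finally show ?thesis
    using fv.dim_Un_le[OF finite_sys_cols[OF finite_channels] finite_ctrl_cols] unfolding sys_cols_ext
    by (meson add_left_mono order_trans)
qed

text \<open>In a vanishing combination the state rows give a recurrence along each delay line:
  \<open>lam\<close> times the coefficient at one delay is the coefficient at the previous delay,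
  with the input coefficient as boundary term. A measurement outside \<open>s\<close> gives a zero
  somewhere on line \<open>j\<close>, the recurrence carries it back to the input, and division by
  \<open>lam\<close> then clears every line. With \<open>h = 0\<close> the inputs are left out and
  only the division is needed.\<close>

lemma dim_ctrl_cols_ge:
  assumes lam: "lam \<noteq> 0"
    and j: "h = 0 \<or> h = nz j \<and> j \<in> s \<and> (\<exists>i<m. i \<notin> s \<and> j \<in> N i)"
  shows "Nz m nz dd + h \<le> fv.dim ctrl_cols"
proof (rule ccontr)
  define f where "f = case_sum zcol (\<lambda>e. vcol (j, e))"
  define I where "I = {..<Nz m nz dd} <+> {..<h}"
  have finI: "finite I" by (simp add: I_def)
  have fI: "f ` I \<subseteq> ctrl_cols" using j by (auto simp: f_def I_def ctrl_cols_def)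
  assume "\<not> Nz m nz dd + h \<le> fv.dim ctrl_cols"
  moreover have "fv.dim (f ` I) \<le> fv.dim ctrl_cols" by (rule fv.dim_subset_finite[OF finite_ctrl_cols fI])
  ultimately have "fv.dim (f ` I) < card I" by (simp add: I_def card_Plus)
  then obtain \<alpha> x where x: "x \<in> I" "\<alpha> x \<noteq> 0" "(\<Sum>y\<in>I. fscale (\<alpha> y) (f y)) = 0"
    by (rule fv.dim_image_less_cardD[OF finI])
  define a where "a q = \<alpha> (Inl q)" for q
  define \<beta> where "\<beta> e = \<alpha> (Inr e)" for e
  have rel: "(\<Sum>q<Nz m nz dd. a q * zcol q r) + (\<Sum>e<h. \<beta> e * vcol (j, e) r) = 0" for r
    using fun_cong[OF x(3), of r] by (simp add: sum_fun_apply I_def sum.Plus a_def \<beta>_def f_def)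
  have shift: "lam * a (enc k \<delta> e) = (if \<delta> = 0 then 0 else a (enc k (\<delta> - 1) e)) -
      (if k = j \<and> \<delta> = 0 \<and> e < h then \<beta> e else 0)" if k: "k < m" "\<delta> \<le> dd k" "e < nz k" for k \<delta> e
  proof -
    let ?p = "enc k \<delta> e"
    have p: "zoff nz dd k \<le> ?p" "?p < zoff nz dd (Suc k)" "?p < Nz m nz dd"
      using delay_index_block[of \<delta> dd k e nz] delay_index_Nz[of k m \<delta> dd e nz] k by auto
    have "(\<Sum>q<Nz m nz dd. a q * zcol q (Inl (n + ?p))) = (\<Sum>q<Nz m nz dd. if ?p = q then lam * a q else 0) -
        (\<Sum>q<Nz m nz dd. if zoff nz dd k \<le> q \<and> q < zoff nz dd (Suc k) \<and> ?p = q + nz k then a q else 0)"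
      unfolding sum_subtractf[symmetric]
      by (rule sum.cong) (use k(3) in \<open>auto simp: zcol_block[OF k(1) p(1,2)]\<close>)
    also have "(\<Sum>q<Nz m nz dd. if ?p = q then lam * a q else 0) = lam * a ?p" using p(3) by simp
    also have "(\<Sum>q<Nz m nz dd. if zoff nz dd k \<le> q \<and> q < zoff nz dd (Suc k) \<and> ?p = q + nz k then a q else 0) =
        (if \<delta> = 0 then 0 else a (enc k (\<delta> - 1) e))"
    proof (cases \<delta>)
      case 0
      then show ?thesis using k(3) by (auto intro!: sum.neutral)
    next
      case (Suc \<delta>')
      have "(\<Sum>q<Nz m nz dd. if zoff nz dd k \<le> q \<and> q < zoff nz dd (Suc k) \<and> ?p = q + nz k then a q else 0) =
          (\<Sum>q<Nz m nz dd. if enc k \<delta>' e = q then a q else 0)"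
        by (rule sum.cong) (use p in \<open>auto simp: Suc\<close>)
      then show ?thesis using p(3) by (simp add: Suc)
    qed
    finally have 1: "(\<Sum>q<Nz m nz dd. a q * zcol q (Inl (n + ?p))) =
        lam * a ?p - (if \<delta> = 0 then 0 else a (enc k (\<delta> - 1) e))" .
    have "vcol (j, e') (Inl (n + ?p)) = (if k = j \<and> \<delta> = 0 \<and> e = e' then 1 else 0)" if "e' < h" for e'
    proof (cases "k = j \<and> \<delta> = 0")
      case True
      then show ?thesis by (auto simp: vcol_def)
    next
      case False
      have e': "e' < nz j" using that j by auto
      have "?p \<noteq> zoff nz dd j + e'"
      proof
        assume eq: "?p = zoff nz dd j + e'"
        moreover have "zoff nz dd j + e' < zoff nz dd (Suc j)"
          using delay_index_block(2)[of 0 dd j e' nz] e' by simp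
        ultimately have "k = j" using zoff_block_unique[OF p(1,2), of j] by simp
        then have "\<delta> \<noteq> 0" "\<delta> * nz k + e = e'" using False eq by auto
        then show False using e' \<open>k = j\<close> by (cases \<delta>) auto
      qed
      then show ?thesis using False by (simp add: vcol_def add.assoc)
    qed
    then have "(\<Sum>e'<h. \<beta> e' * vcol (j, e') (Inl (n + ?p))) = (\<Sum>e'<h. if e = e' then (if k = j \<and> \<delta> = 0 then \<beta> e' else 0) else 0)"
      by (intro sum.cong) auto
    also have "\<dots> = (if k = j \<and> \<delta> = 0 \<and> e < h then \<beta> e else 0)" by simp
    finally show ?thesis using rel[of "Inl (n + ?p)"] unfolding 1 by (auto simp: algebra_simps)
  qed
  have \<beta>: "\<beta> e = 0" if e: "e < h" for e
  proof -
    obtain i where i: "i < m" "i \<notin> s" "j \<in> N i" and h: "h = nz j" using j e by auto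
    have ej: "e < nz j" using e h by simp
    have jm: "j < m" using i N by (meson atLeastLessThan_iff subsetD)
    have dj: "d j i \<le> dd j" using delay i by blast
    obtain b where b: "dim_row (C i) \<le> b" "b < dim_row (Ce i)"
      "\<forall>c<nN. Ce i $$ (b, c) = (if c = n + zoff nz dd j + d j i * nz j + e then 1 else 0)"
      by (rule Ce_row_ex[OF i(1) i(3) ej])
    have "zcol q (Inr (i, b)) = (if enc j (d j i) e = q then 1 else 0)" if "q < Nz m nz dd" for q
      using that b i by (auto simp: zcol_def state_col_def)
    then have "(\<Sum>q<Nz m nz dd. a q * zcol q (Inr (i, b))) = (\<Sum>q<Nz m nz dd. if enc j (d j i) e = q then a q else 0)"
      by (intro sum.cong) auto
    also have "\<dots> = a (enc j (d j i) e)" using delay_index_Nz[of j m "d j i" dd e nz] jm dj ej by simp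
    finally have last: "a (enc j (d j i) e) = 0" using rel[of "Inr (i, b)"] by (simp add: vcol_def)
    \<comment> \<open>The descent from the measured delay to delay 0 only multiplies by
      \<open>lam\<close>; truncated subtraction lets the induction stand still once delay 0 is
      reached.\<close>
    have "a (enc j (d j i - t) e) = 0" for t
    proof (induction t)
      case (Suc t)
      show ?case
      proof (cases "t < d j i")
        case True
        define \<delta> where "\<delta> = d j i - Suc t"
        have "d j i - t = Suc \<delta>" using True by (simp add: \<delta>_def)
        moreover have "Suc \<delta> \<le> dd j" using dj True by (simp add: \<delta>_def)
        ultimately show ?thesis using Suc shift[of j "Suc \<delta>" e] jm ej by (simp add: \<delta>_def[symmetric])
      next
        case False
        then show ?thesis using Suc by simp
      qed
    qed (use last in simp)
    \<comment> \<open>At delay 0 the recurrence equates \<open>lam\<close> times the coefficient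
      with minus the input coefficient.\<close>
    from this[of "d j i"] show ?thesis using shift[of j 0 e] jm ej e by simp
  qed
  \<comment> \<open>Ascent along every line, measured or not; each step divides by
    \<open>lam\<close>.\<close>
  have a: "a (enc k \<delta> e) = 0" if "k < m" "\<delta> \<le> dd k" "e < nz k" for k \<delta> e
    using that
  proof (induction \<delta>)
    case 0
    then show ?case using shift[of k 0 e] \<beta> lam by (auto split: if_splits)
  next
    case (Suc \<delta>)
    then show ?case using shift[of k "Suc \<delta>" e] lam by simp
  qed
  have "a q = 0" if "q < Nz m nz dd" for q
    using delay_indexE[OF that] a by metis
  then have "\<alpha> x = 0" using x(1) \<beta> by (auto simp: I_def a_def \<beta>_def)
  then show False using x(2) by simp
qed

text \<open>The adjoined columns vanish on the rows of the original system and the original columns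
  vanish off them, so erasing those rows kills the original columns and fixes the adjoined
  ones.\<close>

lemma dim_sys_cols_ext_ge:
  "fv.dim (sys_cols m A B C s lam) + fv.dim ctrl_cols \<le> fv.dim (sys_cols m Ae Be Ce s lam)"
proof -
  define P where "P v r = (case r of Inl p \<Rightarrow> if p < n then 0 else v r | Inr (i, b) \<Rightarrow> if b < dim_row (C i) then 0 else v r)"
    for v :: "nat + nat \<times> nat \<Rightarrow> complex" and r
  have lin: "Vector_Spaces.linear fscale fscale P"
    by (rule linear_fscaleI) (auto simp: P_def fun_eq_iff split: sum.split)
  have "P v = v" if "v \<in> ctrl_cols" for v
    using that zcol_state zcol_output
    by (auto simp: ctrl_cols_def P_def fun_eq_iff vcol_def split: sum.split)
  then have "P ` ctrl_cols = ctrl_cols" by simp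
  moreover have "P v = 0" if "v \<in> sys_cols m A B C s lam" for v
    using that by (auto simp: sys_cols_def P_def fun_eq_iff state_col_def input_col_def state_dims split: sum.split)
  ultimately show ?thesis unfolding sys_cols_ext
    using fvp.dim_add_dim_image_le[OF lin finite_sys_cols[OF finite_channels] finite_ctrl_cols] by metis
qed

end

section \<open>The spectrum of the plant and the final criterion\<close>

lemma eigenvalue_if_fixed_eigenvalue:
  assumes A: "A \<in> carrier_mat n n" and B: "\<forall>i<m. dim_row (B i) = n" and C: "\<forall>i<m. dim_col (C i) = n"
    and fixed: "fixed_eigenvalue m A B C lam"
  shows "lam \<in> spectrum_c A"
proof -
  \<comment> \<open>Zero gains are admissible and leave the loop open.\<close>
  define F where "F i = (0\<^sub>m (dim_col (B i)) (dim_row (C i)) :: real mat)" for i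
  have F: "\<forall>i<m. F i \<in> carrier_mat (dim_col (B i)) (dim_row (C i))" by (simp add: F_def)
  have zero: "F i $$ (a, b) = 0" if "a < dim_col (B i)" "b < dim_row (C i)" for i a b
    using that by (simp add: F_def)
  have "feedback_mat m A B C F = A"
    using A feedback_mat_entry[OF A B C F] by (intro eq_matI) (auto simp: zero)
  then show ?thesis using fixed F unfolding fixed_eigenvalue_def spectrum_c_def by fastforce
qed

text \<open>Finiteness makes the \<open>Min\<close> over subsets and eigenvalues a genuine lower
  bound.\<close>

lemma finite_spectrum_c: "A \<in> carrier_mat n n \<Longrightarrow> finite (spectrum_c A)"
proof -
  assume "A \<in> carrier_mat n n"
  then have A: "map_mat complex_of_real A \<in> carrier_mat n n" by simp
  have "char_poly (map_mat complex_of_real A) \<noteq> 0" using degree_monic_char_poly[OF A] by fastforce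
  then show ?thesis unfolding spectrum_c_def eigenvalue_root_char_poly[OF A] by (rule poly_roots_finite)
qed

theorem theorem4:
  fixes n m :: nat
    and A :: "real mat"
    and B C :: "nat \<Rightarrow> real mat"
    and N :: "nat \<Rightarrow> nat set"
    and d :: "nat \<Rightarrow> nat \<Rightarrow> nat"
    and nz :: "nat \<Rightarrow> nat"
    and lam :: complex
  assumes A_dim: "A \<in> carrier_mat n n"
    and B_dim: "\<forall>i<m. dim_row (B i) = n"
    and C_dim: "\<forall>i<m. dim_col (C i) = n"
    and ctrb: "jointly_controllable m A B"
    and obsv: "jointly_observable m A C"
    and N_sub: "\<forall>i<m. N i \<subseteq> {0..<m}"
    and N_self: "\<forall>i<m. i \<in> N i"
    and wc: "weakly_connected m N"
    and d_self: "\<forall>i<m. d i i = 0"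
    and nz_bound: "\<forall>i<m. int (nz i) \<ge> int n -
        int (Min {mrank (test_mat m A B C s mu) | s mu. s \<subseteq> {0..<m} \<and> mu \<in> spectrum_c A})"
    and lam_nz: "lam \<noteq> 0"
  shows "(\<not> fixed_eigenvalue m (A_ext m A nz (dmax m N d))
                (B_ext m B nz (dmax m N d))
                (C_ext n m C N d nz (dmax m N d)) lam)
         \<longleftrightarrow> (\<forall>s. s \<subseteq> {0..<m} \<and> mrank (test_mat m A B C s lam) < n
                 \<longrightarrow> N_set N ({0..<m} - s) \<inter> s \<noteq> {})"
proof -
  define dd where "dd = dmax m N d"
  define nN where "nN = n + Nz m nz dd"
  have delay: "\<forall>i<m. \<forall>j\<in>N i. d j i \<le> dd j"
    unfolding dd_def dmax_def by (auto simp: followers_def intro!: Max_ge)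
  let ?Ae = "A_ext m A nz dd" and ?Be = "B_ext m B nz dd" and ?Ce = "C_ext n m C N d nz dd"
  have finN: "finite (N i)" if "i < m" for i using N_sub that finite_subset by blast
  have ext: "?Ae \<in> carrier_mat nN nN" "\<forall>i<m. dim_row (?Be i) = nN" "\<forall>i<m. dim_col (?Ce i) = nN"
    using A_ext_carrier[OF A_dim] B_dim C_dim finN C_ext_dims(2)[of C _ n N]
    by (simp_all add: nN_def B_ext_dims)
  note rank = mrank_test_mat[OF A_dim B_dim C_dim] and rank_ext = mrank_test_mat[OF ext]
  note fixed_iff = fixed_eigenvalue_iff[OF ext]
  note sys = A_dim B_dim C_dim N_sub delay
  show ?thesis unfolding dd_def[symmetric]
  proof (intro iffI allI impI)
    fix s assume nfixed: "\<not> fixed_eigenvalue m ?Ae ?Be ?Ce lam"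
      and s: "s \<subseteq> {0..<m} \<and> mrank (test_mat m A B C s lam) < n"
    show "N_set N ({0..<m} - s) \<inter> s \<noteq> {}"
    proof
      assume "N_set N ({0..<m} - s) \<inter> s = {}"
      \<comment> \<open>The delay lines add at most \<open>Nz m nz dd\<close> to the rank, so the
        same \<open>s\<close> is deficient for the extended system.\<close>
      then have "mrank (test_mat m ?Ae ?Be ?Ce s lam) < nN"
        using dim_sys_cols_ext_le[OF sys, where s = s and nz = nz and lam = lam] s rank[of s lam] rank_ext[of s lam] by (simp add: nN_def)
      then show False using nfixed s unfolding fixed_iff by blast
    qed
  next
    assume sep: "\<forall>s. s \<subseteq> {0..<m} \<and> mrank (test_mat m A B C s lam) < n \<longrightarrow> N_set N ({0..<m} - s) \<inter> s \<noteq> {}"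
    show "\<not> fixed_eigenvalue m ?Ae ?Be ?Ce lam"
    proof
      assume "fixed_eigenvalue m ?Ae ?Be ?Ce lam"
      then obtain s where s: "s \<subseteq> {0..<m}" "mrank (test_mat m ?Ae ?Be ?Ce s lam) < nN"
        unfolding fixed_iff by blast
      let ?r = "mrank (test_mat m A B C s lam)" and ?ctrl = "ctrl_cols n m A C N d nz dd lam s"
      have ge: "?r + fv.dim ?ctrl < nN"
        using dim_sys_cols_ext_ge[OF sys s(1), where nz = nz and lam = lam] s by (simp add: rank rank_ext)
      note ctrl_ge = dim_ctrl_cols_ge[OF sys s(1) lam_nz, where nz = nz]
      \<comment> \<open>Already with \<open>h = 0\<close> the adjoined columns account for
        \<open>Nz m nz dd\<close>, so the deficit must come from the original test matrix and
        \<open>sep\<close> applies to \<open>s\<close>.\<close>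
      have less: "?r < n" using ge ctrl_ge[of 0] by (simp add: nN_def)
      then have "N_set N ({0..<m} - s) \<inter> s \<noteq> {}" using sep s(1) by blast
      then obtain i j where ij: "i < m" "i \<notin> s" "j \<in> N i" "j \<in> s" unfolding N_set_def by auto
      let ?R = "{mrank (test_mat m A B C s mu) | s mu. s \<subseteq> {0..<m} \<and> mu \<in> spectrum_c A}"
      have "?R = (\<lambda>(s, mu). mrank (test_mat m A B C s mu)) ` (Pow {0..<m} \<times> spectrum_c A)" by auto
      then have "finite ?R" using finite_spectrum_c[OF A_dim] by simp
      \<comment> \<open>The deficient test matrix makes \<open>lam\<close> a fixed eigenvalue of the
        original system, so the minimum in \<open>nz_bound\<close> covers it.\<close>
      moreover have "lam \<in> spectrum_c A"
        using eigenvalue_if_fixed_eigenvalue[OF A_dim B_dim C_dim]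
          fixed_eigenvalue_iff[OF A_dim B_dim C_dim] s(1) less by blast
      ultimately have "Min ?R \<le> ?r" using s(1) by (intro Min_le) auto
      moreover have "int n - int (Min ?R) \<le> int (nz j)" using nz_bound ij s(1) by auto
      ultimately have "n \<le> nz j + ?r" by linarith
      \<comment> \<open>The agent \<open>j\<close> that is heard from outside \<open>s\<close>
        supplies \<open>nz j\<close> further dimensions, enough to fill the whole deficit
        \<open>n - ?r\<close>, which contradicts \<open>ge\<close>.\<close>
      moreover have "Nz m nz dd + nz j \<le> fv.dim ?ctrl" using ctrl_ge ij by blast
      ultimately show False using ge by (simp add: nN_def)
    qed
  qed
qed

end
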